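(* Let $(D_n)_{n\in\mathbb N}$ be a sequence of subsets of $\mathbb Z^d$ satisfying the geometric assumption, with scaling vectors $\mathbf c_n$, and let $(\xi_v)_{v\in\mathbb Z^d}$ be a stationary real-valued random field satisfying condition $\mathcal D(x_n;K_n)$ for some real sequence $(x_n)_{n\in\mathbb N}$, with associated vectors $\boldsymbol\gamma_n$ and constants $\alpha_n$. If $(k_n)$ is a sequence of integers satisfying $k_n\to\infty$, $k_n\alpha_n\to0$ and $k_n^{1/d}\boldsymbol\gamma_n=o(\mathbf c_n)$ as $n\to\infty$, then $$\mathbb P\bigl(M_\xi(D_n)\le x_n\bigr)\le \exp\Bigl(-|D_n|\,\mathbb P\bigl(M_\xi(A_0^{n,k_n})\le x_n<\xi_0\bigr)\Bigr)+o(1)$$ as $n\to\infty$. If furthermore $\limsup_{n\to\infty}|D_n|\,\mathbb P(\xi_0>x_n)<\infty$, then $$\mathbb P\bigl(M_\xi(D_n)\le x_n\bigr)= \exp\Bigl(-|D_n|\,\mathbb P\bigl(M_\xi(A_0^{n,k_n})\le x_n<\xi_0\bigr)\Bigr)+o(1)$$ as $n\to\infty$.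
   Context: Notation: $d\in\mathbb N$; $|\cdot|$ denotes the Euclidean norm of a point, Lebesgue measure of a full-dimensional subset of $\mathbb R^d$, and cardinality of a subset of $\mathbb Z^d$. For a vector $\mathbf r=(r_1,\dots,r_d)$ and $A\subseteq\mathbb R^d$, $\mathbf rA=\{(r_1a_1,\dots,r_da_d):a\in A\}$. $A\oplus B$ is the Minkowski sum, $B(1)$ the closed Euclidean unit ball. For vectors, $\mathbf r_n=o(\mathbf c_n)$ means $r_{n,\ell}/c_{n,\ell}\to0$ for each $\ell$. $M_\xi(A)=\max_{v\in A}\xi_v$, with $M_\xi(\emptyset)=-\infty$. Geometric assumption on $(D_n)$: A convex body is a compact convex subset of $\mathbb R^d$ with non-empty interior; a set is $p$-convex if it is a union of $p$ convex bodies. There are $p\in\mathbb N$ and $p$-convex sets $C_n=\bigcup_{i=1}^pC_{n,i}$ with $D_n=C_n\cap\mathbb Z^d$ and $|C_n|\to\infty$, and vectors $\mathbf c_n=(c_{n,1},\dots,c_{n,d})$ (scaling vectors) with $0<c_{n,\ell}<\infty$ such that (i) $c_{n,\ell}\to\infty$ for all $\ell$; (ii) $c_{n,1}\cdots c_{n,d}\sim|C_n|$; (iii) for some $0<c<\infty$, $C_n\subseteq\mathbf c_n[-c,c]^d$ for all $n$. Boxes: every sequence $(k_n)$ considered consists of positive integers with $k_n\to\infty$ and $k_n^{1/d}=o(c_{n,\ell})$ for all $\ell$. Put $t_{n,k_n}^\ell=\lfloor c_{n,\ell}/k_n^{1/d}\rfloor$, $\mathbf t_{n,k_n}=(t_{n,k_n}^1,\dots,t_{n,k_n}^d)$,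 and for $z\in\mathbb Z^d$, $I_z^{n,k_n}=\mathbf t_{n,k_n}(z+[0,1)^d)$, $J_z^{n,k_n}=I_z^{n,k_n}\cap\mathbb Z^d$, and $D_{n,k_n}^+=\bigcup\{J_z^{n,k_n}: I_z^{n,k_n}\cap C_n\ne\emptyset\}$. $K_n=\mathbb Z^d\cap\mathbf c_n[-c,c]^d$, where $0<c<\infty$ is a fixed constant (which can be chosen independently of $(k_n)$) such that $D_{n,k_n}^+\subseteq K_n$ for all $n$. Condition $\mathcal D(x_n;K_n)$: sets $A,B\subseteq\mathbb Z^d$ are $\boldsymbol\gamma$-separated if $B\subseteq(A\oplus\boldsymbol\gamma B(1))^c$. The condition holds for $(\xi_v)$ if there is an increasing sequence of $d$-dimensional vectors $\boldsymbol\gamma_n$ with $\boldsymbol\gamma_n=o(\mathbf c_n)$ and constants $\alpha_n\to0$ such that for all $n$ and all $\boldsymbol\gamma_n$-separated $A,B\subseteq K_n$, at least one of which is a box, $|\mathbb P(M_\xi(A\cup B)\le x_n)-\mathbb P(M_\xi(A)\le x_n)\mathbb P(M_\xi(B)\le x_n)|\le\alpha_n$. Order: $\preceq$ is an arbitrary fixed translation invariant total order on $\mathbb Z^d$, and $A_v^{n,k_n}=\{z\in(v+\mathbf t_{n,k_n}[-1,1]^d)\cap\mathbb Z^d: v\prec z\}$. *)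

theory Defs
  imports
    "HOL-Probability.Probability"
    "HOL-Library.Landau_Symbols"
    "HOL-Library.Set_Algebras"
begin

(* The lattice Z^d is the type int^'d, with d = CARD('d); to_R is its inclusion into R^d. *)

definition to_R :: "int^'d \<Rightarrow> real^'d" where
  "to_R z = (\<chi> l. real_of_int (z $ l))"

definition lattice_points :: "(real^'d) set \<Rightarrow> (int^'d) set" where
  "lattice_points S = {z. to_R z \<in> S}"

(* The multiplication of type real^'d is componentwise. *)
definition scale :: "real^'d \<Rightarrow> (real^'d) set \<Rightarrow> (real^'d) set" where
  "scale r A = (\<lambda>a. r * a) ` A"

definition sym_cube :: "real \<Rightarrow> (real^'d) set" where
  "sym_cube c = cbox (vec (- c)) (vec c)"

definition vec_small_o :: "(nat \<Rightarrow> real^'d) \<Rightarrow> (nat \<Rightarrow> real^'d) \<Rightarrow> bool" where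
  "vec_small_o r c \<longleftrightarrow> (\<forall>l. (\<lambda>n. r n $ l / c n $ l) \<longlonglongrightarrow> 0)"

definition convex_body :: "(real^'d) set \<Rightarrow> bool" where
  "convex_body S \<longleftrightarrow> compact S \<and> convex S \<and> interior S \<noteq> {}"

definition p_convex :: "nat \<Rightarrow> (real^'d) set \<Rightarrow> bool" where
  "p_convex p S \<longleftrightarrow> (\<exists>B. (\<forall>i<p. convex_body (B i)) \<and> S = (\<Union>i<p. B i))"

definition geometric_assumption ::
    "(nat \<Rightarrow> (int^'d) set) \<Rightarrow> (nat \<Rightarrow> (real^'d) set) \<Rightarrow> (nat \<Rightarrow> real^'d) \<Rightarrow> bool" where
  "geometric_assumption D C c \<longleftrightarrow>
     (\<exists>p>0. \<forall>n. p_convex p (C n)) \<and>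
     (\<forall>n. D n = lattice_points (C n)) \<and>
     filterlim (\<lambda>n. measure lebesgue (C n)) at_top sequentially \<and>
     (\<forall>n l. 0 < c n $ l) \<and>
     (\<forall>l. filterlim (\<lambda>n. c n $ l) at_top sequentially) \<and>
     (\<lambda>n. \<Prod>l\<in>UNIV. c n $ l) \<sim>[sequentially] (\<lambda>n. measure lebesgue (C n)) \<and>
     (\<exists>b>0. \<forall>n. C n \<subseteq> scale (c n) (sym_cube b))"

definition k_root :: "'d itself \<Rightarrow> nat \<Rightarrow> real" where
  "k_root _ k = root CARD('d) (real k)"

definition admissible :: "(nat \<Rightarrow> real^'d) \<Rightarrow> (nat \<Rightarrow> nat) \<Rightarrow> bool" where
  "admissible c k \<longleftrightarrow>
     (\<forall>n. 0 < k n) \<and> filterlim k at_top sequentially \<and>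
     (\<forall>l. (\<lambda>n. k_root TYPE('d) (k n) / c n $ l) \<longlonglongrightarrow> 0)"

(* In the following definitions, c and k stand for the n-th terms of the respective sequences. *)

definition tvec :: "real^'d \<Rightarrow> nat \<Rightarrow> real^'d" where
  "tvec c k = (\<chi> l. real_of_int \<lfloor>c $ l / k_root TYPE('d) k\<rfloor>)"

definition I_block :: "real^'d \<Rightarrow> nat \<Rightarrow> int^'d \<Rightarrow> (real^'d) set" where
  "I_block c k z = scale (tvec c k) ({to_R z} + {x. \<forall>l. 0 \<le> x $ l \<and> x $ l < 1})"

definition J_block :: "real^'d \<Rightarrow> nat \<Rightarrow> int^'d \<Rightarrow> (int^'d) set" where
  "J_block c k z = lattice_points (I_block c k z)"

definition D_plus :: "(real^'d) set \<Rightarrow> real^'d \<Rightarrow> nat \<Rightarrow> (int^'d) set" where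
  "D_plus C c k = \<Union>{J_block c k z |z. I_block c k z \<inter> C \<noteq> {}}"

definition K_set :: "real \<Rightarrow> real^'d \<Rightarrow> (int^'d) set" where
  "K_set \<kappa> c = lattice_points (scale c (sym_cube \<kappa>))"

definition translation_invariant_total_order :: "(int^'d) rel \<Rightarrow> bool" where
  "translation_invariant_total_order R \<longleftrightarrow>
     linear_order R \<and> (\<forall>u v w. (u, v) \<in> R \<longrightarrow> (u + w, v + w) \<in> R)"

(* R is the reflexive relation, so v strictly precedes z iff (v, z) lies in R - Id. *)
definition A_set :: "(int^'d) rel \<Rightarrow> real^'d \<Rightarrow> nat \<Rightarrow> int^'d \<Rightarrow> (int^'d) set" where
  "A_set R c k v =
     {z \<in> lattice_points ({to_R v} + scale (tvec c k) (sym_cube 1)). (v, z) \<in> R - Id}"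

(* A random field is a family X :: int^'d => 'w => real of random variables on M. *)

definition stationary_field :: "'w measure \<Rightarrow> (int^'d \<Rightarrow> 'w \<Rightarrow> real) \<Rightarrow> bool" where
  "stationary_field M X \<longleftrightarrow>
     (\<forall>v. X v \<in> borel_measurable M) \<and>
     (\<forall>u S. finite S \<longrightarrow>
        distr M (Pi\<^sub>M S (\<lambda>_. borel)) (\<lambda>\<omega>. \<lambda>v\<in>S. X (v + u) \<omega>) =
        distr M (Pi\<^sub>M S (\<lambda>_. borel)) (\<lambda>\<omega>. \<lambda>v\<in>S. X v \<omega>))"

(* Only meaningful for finite A; all index sets to which it is applied below are finite. *)
definition field_max :: "(int^'d \<Rightarrow> 'w \<Rightarrow> real) \<Rightarrow> (int^'d) set \<Rightarrow> 'w \<Rightarrow> ereal" where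
  "field_max X A \<omega> = (if A = {} then - \<infinity> else ereal (Max ((\<lambda>v. X v \<omega>) ` A)))"

definition separated :: "real^'d \<Rightarrow> (int^'d) set \<Rightarrow> (int^'d) set \<Rightarrow> bool" where
  "separated g A B \<longleftrightarrow> to_R ` B \<subseteq> - (to_R ` A + scale g (cball 0 1))"

definition is_box :: "(int^'d) set \<Rightarrow> bool" where
  "is_box A \<longleftrightarrow> (\<exists>a b. A = {z. \<forall>l. a $ l \<le> z $ l \<and> z $ l \<le> b $ l})"

definition condition_D ::
    "'w measure \<Rightarrow> (int^'d \<Rightarrow> 'w \<Rightarrow> real) \<Rightarrow> (nat \<Rightarrow> real^'d) \<Rightarrow> (nat \<Rightarrow> real) \<Rightarrow>
     (nat \<Rightarrow> (int^'d) set) \<Rightarrow> (nat \<Rightarrow> real^'d) \<Rightarrow> (nat \<Rightarrow> real) \<Rightarrow> bool" where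
  "condition_D M X c x K \<gamma> \<alpha> \<longleftrightarrow>
     incseq \<gamma> \<and> vec_small_o \<gamma> c \<and> \<alpha> \<longlonglongrightarrow> 0 \<and>
     (\<forall>n A B. A \<subseteq> K n \<and> B \<subseteq> K n \<and> separated (\<gamma> n) A B \<and> (is_box A \<or> is_box B) \<longrightarrow>
        \<bar>\<P>(\<omega> in M. field_max X (A \<union> B) \<omega> \<le> ereal (x n))
          - \<P>(\<omega> in M. field_max X A \<omega> \<le> ereal (x n))
            * \<P>(\<omega> in M. field_max X B \<omega> \<le> ereal (x n))\<bar> \<le> \<alpha> n)"

end

theory Submission
  imports Defs
begin

text \<open>
  Cut the lattice into blocks \<open>J\<close> of side lengths \<open>t\<close> and shrink each to a core \<open>J'\<close> of side lengths
  \<open>t - \<lfloor>\<bar>\<gamma>\<bar>\<rfloor> - 1\<close>, so that different cores are \<open>\<gamma>\<close>-separated boxes and condition D factorises the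
  probability that a union of cores has no exceedance, with error \<open>\<alpha>\<close> per core. Since each \<open>C\<^sub>n\<close> is a union of
  \<open>p\<close> convex sets, only \<open>O(k\<^bsup>(d-1)/d\<^esup>)\<close> blocks meet \<open>C\<^sub>n\<close> without being contained in it, and hence
  \<open>k (1 + o(1))\<close> blocks lie inside and \<open>k (1 + o(1))\<close> blocks cover \<open>D\<^sub>n\<close>. Splitting the event of an exceedance in
  a block according to the last exceedance gives \<open>P(M(J') > x) \<ge> |J'| p\<close> with
  \<open>p = P(M(A\<^sub>0) \<le> x < \<xi>\<^sub>0)\<close>, which yields the upper bound. In the other direction,
  \<open>P(M(J) > x) - |J| p\<close> is at most the probability that \<open>J\<close> and one of its \<open>3\<^sup>d - 1\<close> neighbours both contain
  an exceedance; if \<open>|D| P(\<xi>\<^sub>0 > x)\<close> is bounded, condition D makes this \<open>O(1/k\<^sup>2) + O(\<alpha>) + o(1/k) = o(1/k)\<close>.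
\<close>

section \<open>Exceedances of a stationary field\<close>

text \<open>A pointwise form of the event that the maximum over \<open>A\<close> is at most
  \<open>x\<close>. It avoids \<open>Max\<close> and \<open>ereal\<close>, treats the empty set
  uniformly and agrees with \<open>field_max\<close> for finite \<open>A\<close>.\<close>

definition exc_free :: "(int^'d \<Rightarrow> 'w \<Rightarrow> real) \<Rightarrow> real \<Rightarrow> (int^'d) set \<Rightarrow> 'w \<Rightarrow> bool" where
  "exc_free X x A \<omega> \<longleftrightarrow> (\<forall>v\<in>A. X v \<omega> \<le> x)"

lemma field_max_le_iff:
  assumes "finite A"
  shows "field_max X A \<omega> \<le> ereal x \<longleftrightarrow> exc_free X x A \<omega>"
  using assms by (auto simp: field_max_def exc_free_def)

lemma exc_free_Un: "exc_free X x (A \<union> B) \<omega> \<longleftrightarrow> exc_free X x A \<omega> \<and> exc_free X x B \<omega>"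
  by (auto simp: exc_free_def)

lemma exc_free_empty [simp]: "exc_free X x {} \<omega>"
  by (simp add: exc_free_def)

lemma exc_free_mono: "exc_free X x B \<omega> \<Longrightarrow> A \<subseteq> B \<Longrightarrow> exc_free X x A \<omega>"
  by (auto simp: exc_free_def)

text \<open>The threshold \<open>x\<close> is a single number: the asymptotic argument interprets
  the locale separately at each \<open>x n\<close>.\<close>

locale level_field = prob_space M for M :: "'w measure" +
  fixes X :: "int^'d \<Rightarrow> 'w \<Rightarrow> real" and x :: real
  assumes stat: "stationary_field M X"
begin

lemma X_measurable [measurable]: "X v \<in> borel_measurable M"
  using stat by (auto simp: stationary_field_def)

lemma exc_free_measurable [measurable]:
  assumes "finite A"
  shows "Measurable.pred M (exc_free X x A)"
  unfolding exc_free_def using assms by measurable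

definition le_prob :: "(int^'d) set \<Rightarrow> real" where
  "le_prob A = \<P>(\<omega> in M. exc_free X x A \<omega>)"

definition exc_prob :: real where
  "exc_prob = \<P>(\<omega> in M. x < X 0 \<omega>)"

text \<open>For \<open>A\<close> the part of a window lying after the origin, this is the
  probability in the exponent of the limit statement.\<close>

definition last_prob :: "(int^'d) set \<Rightarrow> real" where
  "last_prob A = \<P>(\<omega> in M. exc_free X x A \<omega> \<and> x < X 0 \<omega>)"

lemma le_prob_nonneg [simp]: "0 \<le> le_prob A"
  and le_prob_le_1 [simp]: "le_prob A \<le> 1"
  and exc_prob_nonneg [simp]: "0 \<le> exc_prob"
  and last_prob_nonneg [simp]: "0 \<le> last_prob A"
  by (simp_all add: le_prob_def exc_prob_def last_prob_def)

text \<open>Stationarity is an equality of push-forward measures on finite windows. Evaluating both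
  at the set where \<open>Q\<close> holds carries any measurable finite-window event from one
  position to another.\<close>

lemma prob_shift:
  assumes S: "finite S" and Q: "Measurable.pred (Pi\<^sub>M S (\<lambda>_. borel)) Q"
  shows "\<P>(\<omega> in M. Q (\<lambda>v\<in>S. X (v + u) \<omega>)) = \<P>(\<omega> in M. Q (\<lambda>v\<in>S. X v \<omega>))"
proof -
  let ?N = "Pi\<^sub>M S (\<lambda>_. borel :: real measure)"
  have eq: "distr M ?N (\<lambda>\<omega>. \<lambda>v\<in>S. X (v + u) \<omega>) = distr M ?N (\<lambda>\<omega>. \<lambda>v\<in>S. X v \<omega>)"
    using stat S unfolding stationary_field_def by blast
  have m1 [measurable]: "(\<lambda>\<omega>. \<lambda>v\<in>S. X (v + u) \<omega>) \<in> measurable M ?N"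
   and m2 [measurable]: "(\<lambda>\<omega>. \<lambda>v\<in>S. X v \<omega>) \<in> measurable M ?N"
    by measurable
  have Q': "{f \<in> space ?N. Q f} \<in> sets ?N"
    using Q by measurable
  have "\<P>(\<omega> in M. Q (\<lambda>v\<in>S. X (v + u) \<omega>))
      = measure (distr M ?N (\<lambda>\<omega>. \<lambda>v\<in>S. X (v + u) \<omega>)) {f \<in> space ?N. Q f}"
    using measurable_space[OF m1]
    by (subst measure_distr[OF m1 Q']) (auto intro!: arg_cong[where f = "measure M"])
  also have "\<dots> = \<P>(\<omega> in M. Q (\<lambda>v\<in>S. X v \<omega>))"
    unfolding eq using measurable_space[OF m2]
    by (subst measure_distr[OF m2 Q']) (auto intro!: arg_cong[where f = "measure M"])
  finally show ?thesis .
qed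

lemma last_prob_shift:
  assumes "finite A"
  shows "\<P>(\<omega> in M. exc_free X x ((+) v ` A) \<omega> \<and> x < X v \<omega>) = last_prob A"
proof -
  \<comment> \<open>The event reads the field at the origin too, and the origin need not belong to
    \<open>A\<close>.\<close>
  let ?S = "insert 0 A"
  let ?Q = "\<lambda>f. (\<forall>z\<in>A. f z \<le> x) \<and> x < (f 0 :: real)"
  have Q: "Measurable.pred (Pi\<^sub>M ?S (\<lambda>_. borel)) ?Q"
  proof -
    have [measurable]: "(\<lambda>f. f z) \<in> borel_measurable (Pi\<^sub>M ?S (\<lambda>_. borel :: real measure))"
      if "z \<in> ?S" for z
      using that by measurable
    show ?thesis using assms by measurable
  qed
  have "\<P>(\<omega> in M. ?Q (\<lambda>z\<in>?S. X (z + v) \<omega>)) = \<P>(\<omega> in M. ?Q (\<lambda>z\<in>?S. X z \<omega>))"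
    by (rule prob_shift) (use assms Q in auto)
  then show ?thesis
    by (simp add: last_prob_def exc_free_def add.commute)
qed

lemma exc_prob_shift: "\<P>(\<omega> in M. x < X v \<omega>) = exc_prob"
  using last_prob_shift[of "{}" v] by (simp add: last_prob_def exc_prob_def)

lemma le_prob_shift:
  assumes "finite A"
  shows "le_prob ((+) u ` A) = le_prob A"
proof -
  let ?Q = "\<lambda>f. \<forall>z\<in>A. f z \<le> (x :: real)"
  have Q: "Measurable.pred (Pi\<^sub>M A (\<lambda>_. borel)) ?Q"
  proof -
    have [measurable]: "(\<lambda>f. f z) \<in> borel_measurable (Pi\<^sub>M A (\<lambda>_. borel :: real measure))"
      if "z \<in> A" for z
      using that by measurable
    show ?thesis using assms by measurable
  qed
  have "\<P>(\<omega> in M. ?Q (\<lambda>z\<in>A. X (z + u) \<omega>)) = \<P>(\<omega> in M. ?Q (\<lambda>z\<in>A. X z \<omega>))"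
    by (rule prob_shift) (use assms Q in auto)
  then show ?thesis
    by (simp add: le_prob_def exc_free_def add.commute)
qed

lemma le_prob_antimono:
  assumes "A \<subseteq> B" "finite B"
  shows "le_prob B \<le> le_prob A"
  unfolding le_prob_def using assms finite_subset[OF assms]
  by (intro finite_measure_mono) (auto dest: exc_free_mono)

lemma le_prob_exc: "finite A \<Longrightarrow> \<P>(\<omega> in M. \<not> exc_free X x A \<omega>) = 1 - le_prob A"
  unfolding le_prob_def using prob_neg[of "exc_free X x A"] exc_free_measurable by simp

lemma exc_union_bound:
  assumes "finite A"
  shows "\<P>(\<omega> in M. \<not> exc_free X x A \<omega>) \<le> real (card A) * exc_prob"
proof -
  have "{\<omega> \<in> space M. \<not> exc_free X x A \<omega>} = (\<Union>v\<in>A. {\<omega> \<in> space M. x < X v \<omega>})"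
    by (auto simp: exc_free_def not_le)
  also have "prob \<dots> \<le> (\<Sum>v\<in>A. prob {\<omega> \<in> space M. x < X v \<omega>})"
    using assms by (intro finite_measure_subadditive_finite) auto
  finally show ?thesis by (simp add: exc_prob_shift)
qed

text \<open>If \<open>A\<close> has no exceedance but \<open>B\<close> has one, it sits in
  \<open>B - A\<close>, where the union bound applies. This is the price of passing from cores back
  to full blocks.\<close>

lemma le_prob_diff:
  assumes "A \<subseteq> B" "finite B"
  shows "le_prob A \<le> le_prob B + (real (card B) - card A) * exc_prob"
proof -
  have fin: "finite A" "finite (B - A)" using assms finite_subset by auto
  have "le_prob A \<le> prob ({\<omega> \<in> space M. exc_free X x B \<omega>} \<union> {\<omega> \<in> space M. \<not> exc_free X x (B - A) \<omega>})"
    unfolding le_prob_def using assms fin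
    by (intro finite_measure_mono sets.Un) (auto simp: exc_free_def)
  also have "\<dots> \<le> le_prob B + prob {\<omega> \<in> space M. \<not> exc_free X x (B - A) \<omega>}"
    unfolding le_prob_def using assms fin by (intro measure_Un_le) auto
  also have "\<dots> \<le> le_prob B + real (card (B - A)) * exc_prob"
    using exc_union_bound[OF fin(2)] by simp
  also have "real (card (B - A)) = real (card B) - card A"
    using assms fin by (simp add: card_Diff_subset card_mono of_nat_diff)
  finally show ?thesis .
qed

end

section \<open>Decomposition of an exceedance event by its last exceedance\<close>

lemma finite_linear_order_max:
  assumes "linear_order R" "finite A" "A \<noteq> {}"
  shows "\<exists>m\<in>A. \<forall>z\<in>A. (m, z) \<notin> R - Id"
  using assms(2,3)
proof (induction rule: finite_ne_induct)
  case (singleton a)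
  then show ?case by simp
next
  case (insert a A)
  then obtain m where m: "m \<in> A" "\<forall>z\<in>A. (m, z) \<notin> R - Id" by blast
  have tot: "total R" and tr: "trans R" and an: "antisym R"
    using assms(1) by (auto simp: linear_order_on_def partial_order_on_def preorder_on_def)
  show ?case
  proof (cases "(m, a) \<in> R - Id")
    case True
    \<comment> \<open>Anything strictly after \<open>a\<close> would by transitivity come after
      \<open>m\<close>, and antisymmetry excludes \<open>m\<close> itself; this contradicts the
      choice of \<open>m\<close>.\<close>
    have "(a, z) \<notin> R - Id" if "z \<in> A" for z
    proof
      assume "(a, z) \<in> R - Id"
      then have "(m, z) \<in> R" "m \<noteq> z"
        using True tr an by (auto dest: transD antisymD)
      with m that show False by auto
    qed
    then show ?thesis by auto
  next
    case False
    then show ?thesis using m by auto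
  qed
qed

context level_field
begin

text \<open>The \<open>v\<close>-th event says that \<open>v\<close> is the last exceedance in
  \<open>J\<close>. A finite nonempty set of exceedances has exactly one last element, so these
  events partition the event of an exceedance in \<open>J\<close>.\<close>

lemma exc_decomp:
  assumes R: "linear_order R" and J: "finite J"
  shows "1 - le_prob J =
    (\<Sum>v\<in>J. \<P>(\<omega> in M. exc_free X x {z\<in>J. (v, z) \<in> R - Id} \<omega> \<and> x < X v \<omega>))"
proof -
  let ?E = "\<lambda>v. {\<omega> \<in> space M. exc_free X x {z\<in>J. (v, z) \<in> R - Id} \<omega> \<and> x < X v \<omega>}"
  have tot: "total R" using R by (simp add: linear_order_on_def)
  have "{\<omega> \<in> space M. \<not> exc_free X x J \<omega>} = (\<Union>v\<in>J. ?E v)"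
  proof (intro equalityI subsetI)
    fix \<omega> assume \<omega>: "\<omega> \<in> {\<omega> \<in> space M. \<not> exc_free X x J \<omega>}"
    define A where "A = {v\<in>J. x < X v \<omega>}"
    have "finite A" "A \<noteq> {}" using J \<omega> by (auto simp: A_def exc_free_def not_le)
    from finite_linear_order_max[OF R this] obtain m
      where "m \<in> A" "\<forall>z\<in>A. (m, z) \<notin> R - Id" by blast
    then have "\<omega> \<in> ?E m" "m \<in> J" using \<omega> by (auto simp: A_def exc_free_def)
    then show "\<omega> \<in> (\<Union>v\<in>J. ?E v)" by blast
  qed (auto simp: exc_free_def not_le)
  then have "1 - le_prob J = prob (\<Union>v\<in>J. ?E v)"
    using le_prob_exc[OF J] by simp
  also have "\<dots> = (\<Sum>v\<in>J. prob (?E v))"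
  proof (intro finite_measure_finite_Union J)
    show "?E ` J \<subseteq> events" using J by auto
    show "disjoint_family_on ?E J"
      unfolding disjoint_family_on_def
    proof (intro ballI impI)
      fix u v assume uv: "u \<in> J" "v \<in> J" "u \<noteq> v"
      \<comment> \<open>By totality one of the two points is later; the event of the earlier one
        forbids an exceedance there, the event of the later one demands it.\<close>
      then have "(u, v) \<in> R - Id \<or> (v, u) \<in> R - Id" using tot by (auto simp: total_on_def)
      with uv show "?E u \<inter> ?E v = {}" by (fastforce simp: exc_free_def)
    qed
  qed
  finally show ?thesis .
qed

text \<open>Having no exceedance in all of \<open>v + A\<close> is more restrictive than having none
  among the later points of \<open>J\<close>. By stationarity every term of
  \<open>exc_decomp\<close> is therefore at least \<open>last_prob A\<close>.\<close>

lemma exc_lower: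
  assumes R: "linear_order R" and J: "finite J" and A: "finite A"
    and sub: "\<And>v. v \<in> J \<Longrightarrow> {z\<in>J. (v, z) \<in> R - Id} \<subseteq> (+) v ` A"
  shows "real (card J) * last_prob A \<le> 1 - le_prob J"
proof -
  have "real (card J) * last_prob A = (\<Sum>v\<in>J. \<P>(\<omega> in M. exc_free X x ((+) v ` A) \<omega> \<and> x < X v \<omega>))"
    by (simp add: last_prob_shift[OF A])
  also have "\<dots> \<le> (\<Sum>v\<in>J. \<P>(\<omega> in M. exc_free X x {z\<in>J. (v, z) \<in> R - Id} \<omega> \<and> x < X v \<omega>))"
    using J by (intro sum_mono finite_measure_mono) (auto dest: exc_free_mono[OF _ sub])
  finally show ?thesis using exc_decomp[OF R J] by simp
qed

text \<open>Let \<open>v\<close> be the last exceedance in \<open>J\<close>. Either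
  \<open>v + A\<close> has no exceedance, or it has one; the latter is later than \<open>v\<close>,
  so it lies outside \<open>J\<close> and hence in \<open>N\<close>.\<close>

lemma exc_upper:
  assumes R: "linear_order R" and J: "finite J" and A: "finite A" and N: "finite N"
    and sub: "\<And>v. v \<in> J \<Longrightarrow> (+) v ` A \<subseteq> J \<union> N"
    and after: "\<And>v. v \<in> J \<Longrightarrow> (+) v ` A \<subseteq> {z. (v, z) \<in> R - Id}"
  shows "1 - le_prob J \<le> real (card J) * last_prob A
    + \<P>(\<omega> in M. \<not> exc_free X x J \<omega> \<and> \<not> exc_free X x N \<omega>)"
proof -
  let ?L = "\<lambda>v \<omega>. exc_free X x {z\<in>J. (v, z) \<in> R - Id} \<omega> \<and> x < X v \<omega>"
  let ?E = "\<lambda>v. {\<omega> \<in> space M. exc_free X x ((+) v ` A) \<omega> \<and> x < X v \<omega>}"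
  let ?F = "\<lambda>v. {\<omega> \<in> space M. ?L v \<omega> \<and> \<not> exc_free X x N \<omega>}"
  have tot: "total R" using R by (simp add: linear_order_on_def)
  have "1 - le_prob J = (\<Sum>v\<in>J. \<P>(\<omega> in M. ?L v \<omega>))"
    by (rule exc_decomp[OF R J])
  also have "\<dots> \<le> (\<Sum>v\<in>J. prob (?E v) + prob (?F v))"
  proof (rule sum_mono)
    fix v assume v: "v \<in> J"
    have "\<P>(\<omega> in M. ?L v \<omega>) \<le> prob (?E v \<union> ?F v)"
      using A J N sub[OF v] after[OF v]
      by (intro finite_measure_mono sets.Un) (auto simp: exc_free_def)
    also have "\<dots> \<le> prob (?E v) + prob (?F v)"
      using A J N by (intro measure_Un_le) auto
    finally show "\<P>(\<omega> in M. ?L v \<omega>) \<le> prob (?E v) + prob (?F v)" .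
  qed
  also have "\<dots> = real (card J) * last_prob A + (\<Sum>v\<in>J. prob (?F v))"
    by (simp add: sum.distrib last_prob_shift[OF A])
  \<comment> \<open>The events \<open>?F v\<close> still fix \<open>v\<close> as the last exceedance
    in \<open>J\<close> and so are disjoint. Their sum is thus one probability, with no factor
    \<open>card J\<close>.\<close>
  also have "(\<Sum>v\<in>J. prob (?F v)) = prob (\<Union>v\<in>J. ?F v)"
  proof (intro finite_measure_finite_Union[symmetric] J)
    show "?F ` J \<subseteq> events" using J N by auto
    show "disjoint_family_on ?F J"
      unfolding disjoint_family_on_def
    proof (intro ballI impI)
      fix u v assume uv: "u \<in> J" "v \<in> J" "u \<noteq> v"
      then have "(u, v) \<in> R - Id \<or> (v, u) \<in> R - Id" using tot by (auto simp: total_on_def)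
      with uv show "?F u \<inter> ?F v = {}" by (fastforce simp: exc_free_def)
    qed
  qed
  also have "prob (\<Union>v\<in>J. ?F v) \<le> \<P>(\<omega> in M. \<not> exc_free X x J \<omega> \<and> \<not> exc_free X x N \<omega>)"
    using J N by (intro finite_measure_mono) (auto simp: exc_free_def not_le)
  finally show ?thesis by simp
qed

text \<open>Inclusion-exclusion for the complements expresses joint exceedance through
  \<open>le_prob\<close>, the quantity that condition D controls.\<close>

lemma exc_both_eq:
  assumes "finite A" "finite B"
  shows "\<P>(\<omega> in M. \<not> exc_free X x A \<omega> \<and> \<not> exc_free X x B \<omega>)
    = 1 - le_prob A - le_prob B + le_prob (A \<union> B)"
proof -
  let ?A = "{\<omega> \<in> space M. exc_free X x A \<omega>}" and ?B = "{\<omega> \<in> space M. exc_free X x B \<omega>}"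
  have [simp]: "?A \<in> events" "?B \<in> events" using assms by auto
  have "{\<omega> \<in> space M. \<not> exc_free X x A \<omega> \<and> \<not> exc_free X x B \<omega>} = space M - (?A \<union> ?B)"
    by auto
  also have "prob \<dots> = 1 - prob (?A \<union> ?B)" by (rule prob_compl) auto
  also have "prob (?A \<union> ?B) = prob ?A + prob ?B - prob (?A \<inter> ?B)"
    using finite_measure_Union'[of ?A ?B] finite_measure_Diff'[of ?B ?A] by (simp add: Int_commute)
  also have "?A \<inter> ?B = {\<omega> \<in> space M. exc_free X x (A \<union> B) \<omega>}"
    by (auto simp: exc_free_Un)
  finally show ?thesis by (simp add: le_prob_def)
qed

text \<open>If both large sets contain an exceedance, then so do both small ones, or one lies in a
  difference set. It is applied with cores inside full blocks.\<close>

lemma exc_both_mono: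
  assumes "A' \<subseteq> A" "B' \<subseteq> B" "finite A" "finite B"
  shows "\<P>(\<omega> in M. \<not> exc_free X x A \<omega> \<and> \<not> exc_free X x B \<omega>)
    \<le> \<P>(\<omega> in M. \<not> exc_free X x A' \<omega> \<and> \<not> exc_free X x B' \<omega>)
      + ((real (card A) - card A') + (real (card B) - card B')) * exc_prob"
proof -
  have fin: "finite A'" "finite B'" using assms finite_subset by auto
  have c: "real (card (A - A')) = real (card A) - card A'" "real (card (B - B')) = real (card B) - card B'"
    using assms fin by (simp_all add: card_Diff_subset card_mono of_nat_diff)
  let ?G = "{\<omega> \<in> space M. \<not> exc_free X x A' \<omega> \<and> \<not> exc_free X x B' \<omega>}"
  let ?H = "{\<omega> \<in> space M. \<not> exc_free X x (A - A') \<omega>}"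
  let ?I = "{\<omega> \<in> space M. \<not> exc_free X x (B - B') \<omega>}"
  have [simp]: "?G \<in> events" "?H \<in> events" "?I \<in> events" using assms fin by auto
  have "\<P>(\<omega> in M. \<not> exc_free X x A \<omega> \<and> \<not> exc_free X x B \<omega>) \<le> prob (?G \<union> (?H \<union> ?I))"
    by (intro finite_measure_mono sets.Un) (auto simp: exc_free_def)
  also have "\<dots> \<le> prob ?G + prob (?H \<union> ?I)" by (intro measure_Un_le) auto
  also have "\<dots> \<le> prob ?G + (prob ?H + prob ?I)" by (intro add_left_mono measure_Un_le) auto
  also have "\<dots> \<le> prob ?G + (real (card (A - A')) * exc_prob + real (card (B - B')) * exc_prob)"
    using assms fin by (intro add_left_mono add_mono exc_union_bound) auto
  finally show ?thesis by (simp add: c algebra_simps)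
qed

lemma exc_both_UN_bound:
  assumes Z: "finite Z" and A: "finite A" and B: "\<And>z. z \<in> Z \<Longrightarrow> finite (B z)"
    and le: "\<And>z. z \<in> Z \<Longrightarrow> \<P>(\<omega> in M. \<not> exc_free X x A \<omega> \<and> \<not> exc_free X x (B z) \<omega>) \<le> b"
  shows "\<P>(\<omega> in M. \<not> exc_free X x A \<omega> \<and> \<not> exc_free X x (\<Union>z\<in>Z. B z) \<omega>) \<le> real (card Z) * b"
proof -
  have "{\<omega> \<in> space M. \<not> exc_free X x A \<omega> \<and> \<not> exc_free X x (\<Union>z\<in>Z. B z) \<omega>}
     = (\<Union>z\<in>Z. {\<omega> \<in> space M. \<not> exc_free X x A \<omega> \<and> \<not> exc_free X x (B z) \<omega>})"
    by (auto simp: exc_free_def)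
  also have "prob \<dots> \<le> (\<Sum>z\<in>Z. \<P>(\<omega> in M. \<not> exc_free X x A \<omega> \<and> \<not> exc_free X x (B z) \<omega>))"
    using assms by (intro finite_measure_subadditive_finite) auto
  also have "\<dots> \<le> (\<Sum>z\<in>Z. b)" by (intro sum_mono le)
  finally show ?thesis by simp
qed

text \<open>Blocks are split off one at a time, each at the cost of one application of the mixing bound.\<close>

lemma le_prob_UN_prod:
  assumes Z: "finite Z" and \<alpha>: "0 \<le> \<alpha>"
    and mix: "\<And>Y z. Y \<subseteq> Z \<Longrightarrow> z \<in> Z - Y \<Longrightarrow>
      \<bar>le_prob ((\<Union>y\<in>Y. B y) \<union> B z) - le_prob (\<Union>y\<in>Y. B y) * le_prob (B z)\<bar> \<le> \<alpha>"
  shows "\<bar>le_prob (\<Union>z\<in>Z. B z) - (\<Prod>z\<in>Z. le_prob (B z))\<bar> \<le> real (card Z) * \<alpha>"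
proof -
  have "\<bar>le_prob (\<Union>z\<in>Y. B z) - (\<Prod>z\<in>Y. le_prob (B z))\<bar> \<le> real (card Y) * \<alpha>"
    if "finite Y" "Y \<subseteq> Z" for Y
    using that
  proof (induction rule: finite_induct)
    case empty
    then show ?case by (simp add: le_prob_def prob_space)
  next
    case (insert z Y)
    let ?U = "\<Union>y\<in>Y. B y" and ?P = "\<Prod>z\<in>Y. le_prob (B z)"
    \<comment> \<open>The error telescopes: the new block contributes one mixing error, and the old
      error is multiplied by a probability, so it does not grow.\<close>
    have "\<bar>le_prob (\<Union>z\<in>insert z Y. B z) - (\<Prod>z\<in>insert z Y. le_prob (B z))\<bar>
        = \<bar>(le_prob (?U \<union> B z) - le_prob ?U * le_prob (B z)) + (le_prob ?U - ?P) * le_prob (B z)\<bar>"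
      using insert by (simp add: algebra_simps Un_commute)
    also have "\<dots> \<le> \<bar>le_prob (?U \<union> B z) - le_prob ?U * le_prob (B z)\<bar> + \<bar>le_prob ?U - ?P\<bar> * le_prob (B z)"
      by (rule order_trans[OF abs_triangle_ineq]) (simp add: abs_mult)
    also have "\<dots> \<le> \<alpha> + \<bar>le_prob ?U - ?P\<bar> * 1"
      using insert by (intro add_mono mix mult_left_mono) auto
    also have "\<dots> \<le> \<alpha> + real (card Y) * \<alpha>" using insert by auto
    finally show ?case using insert by (simp add: algebra_simps)
  qed
  from this[OF Z] show ?thesis by simp
qed

end

section \<open>Blocks and cells of a grid\<close>

lemma int_box_bij:
  fixes a b :: "int^'d"
  shows "bij_betw (\<lambda>z l. z $ l) {z. \<forall>l. a $ l \<le> z $ l \<and> z $ l \<le> b $ l}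
    (PiE UNIV (\<lambda>l. {a $ l..b $ l}))"
  by (rule bij_betwI[where g = "\<lambda>f. \<chi> l. f l"]) (auto simp: PiE_def Pi_def vec_eq_iff)

lemma finite_int_box: "finite {z :: int^'d. \<forall>l. a $ l \<le> z $ l \<and> z $ l \<le> b $ l}"
  using bij_betw_finite[OF int_box_bij[of a b]] by (simp add: finite_PiE)

lemma card_int_box:
  fixes a b :: "int^'d"
  shows "card {z. \<forall>l. a $ l \<le> z $ l \<and> z $ l \<le> b $ l} = (\<Prod>l\<in>UNIV. nat (b $ l - a $ l + 1))"
  using bij_betw_same_card[OF int_box_bij[of a b]] by (simp add: card_PiE)

text \<open>The point \<open>z\<close> is the grid index, not a corner. Being half-open, cells with
  positive sides tile the space, and they coincide with \<open>I_block\<close> for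
  \<open>t = tint c k\<close>.\<close>

definition cell :: "int^'d \<Rightarrow> int^'d \<Rightarrow> (real^'d) set" where
  "cell t z = {y. \<forall>l. of_int (t $ l * z $ l) \<le> y $ l \<and> y $ l < of_int (t $ l * (z $ l + 1))}"

text \<open>Grid spacing \<open>t\<close> and side lengths \<open>s\<close> are separate:
  \<open>s = t\<close> gives the full block, a smaller \<open>s\<close> gives its core at the same
  lower corner.\<close>

definition block :: "int^'d \<Rightarrow> int^'d \<Rightarrow> int^'d \<Rightarrow> (int^'d) set" where
  "block t s z = {v. \<forall>l. t $ l * z $ l \<le> v $ l \<and> v $ l < t $ l * z $ l + s $ l}"

lemma lattice_points_cell: "lattice_points (cell t z) = block t t z"
proof -
  have "real_of_int (v $ l) < of_int (t $ l * (z $ l + 1)) \<longleftrightarrow> v $ l < t $ l * z $ l + t $ l" for v l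
    unfolding of_int_less_iff by (simp add: algebra_simps)
  moreover have "of_int (t $ l * z $ l) \<le> real_of_int (v $ l) \<longleftrightarrow> t $ l * z $ l \<le> v $ l" for v l
    unfolding of_int_le_iff ..
  ultimately show ?thesis
    unfolding lattice_points_def cell_def block_def to_R_def by simp
qed

lemma block_eq_box:
  "block t s z = {v. \<forall>l. (\<chi> l. t $ l * z $ l) $ l \<le> v $ l \<and> v $ l \<le> (\<chi> l. t $ l * z $ l + s $ l - 1) $ l}"
  by (auto simp: block_def; smt (verit))

lemma is_box_block: "is_box (block t s z)"
  unfolding is_box_def block_eq_box by blast

lemma finite_block [simp]: "finite (block t s z)"
  unfolding block_eq_box by (rule finite_int_box)

lemma card_block: "card (block t s z) = (\<Prod>l\<in>UNIV. nat (s $ l))"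
  unfolding block_eq_box by (subst card_int_box) simp

lemma block_shift: "block t s z = (+) (t * z) ` block t s 0"
proof (intro equalityI subsetI)
  fix v assume v: "v \<in> block t s z"
  then have "v - t * z \<in> block t s 0" by (auto simp: block_def algebra_simps)
  moreover have "v = t * z + (v - t * z)" by simp
  ultimately show "v \<in> (+) (t * z) ` block t s 0" by blast
qed (auto simp: block_def)

lemma block_mono: "(\<And>l. s $ l \<le> r $ l) \<Longrightarrow> block t s z \<subseteq> block t r z"
  by (auto simp: block_def) (smt (verit))

lemma cell_disjoint:
  assumes "z \<noteq> w"
  shows "cell t z \<inter> cell t w = {}"
proof (rule ccontr)
  assume "cell t z \<inter> cell t w \<noteq> {}"
  then obtain y where y: "y \<in> cell t z" "y \<in> cell t w" by auto
  have "z $ l = w $ l" for l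
  proof -
    have "real_of_int (t $ l * z $ l) < of_int (t $ l * (w $ l + 1))"
      "real_of_int (t $ l * w $ l) < of_int (t $ l * (z $ l + 1))"
      "real_of_int (t $ l * z $ l) < of_int (t $ l * (z $ l + 1))"
      using y unfolding cell_def by (auto intro: le_less_trans)
    then have "t $ l * z $ l < t $ l * (w $ l + 1)" "t $ l * w $ l < t $ l * (z $ l + 1)"
      "t $ l * z $ l < t $ l * (z $ l + 1)"
      unfolding of_int_less_iff by auto
    \<comment> \<open>Positivity of the spacing is extracted from the common point, since a cell
      containing a point has positive sides.\<close>
    moreover from this(3) have "t $ l > 0" by (simp add: algebra_simps)
    ultimately have "z $ l < w $ l + 1" "w $ l < z $ l + 1"
      by (simp_all only: mult_less_cancel_left_pos)
    then show ?thesis by simp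
  qed
  with assms show False by (simp add: vec_eq_iff)
qed

lemma block_disjoint:
  assumes "z \<noteq> w"
  shows "block t t z \<inter> block t t w = {}"
  using cell_disjoint[OF assms, of t] lattice_points_cell[of t]
  unfolding lattice_points_def by blast

lemma cell_measure:
  fixes t z :: "int^'d"
  assumes t: "\<And>l. t $ l > 0"
  shows "cell t z \<in> lmeasurable"
    and "measure lebesgue (cell t z) = (\<Prod>l\<in>UNIV. of_int (t $ l))"
proof -
  let ?a = "(\<chi> l. of_int (t $ l * z $ l)) :: real^'d" and ?b = "(\<chi> l. of_int (t $ l * (z $ l + 1))) :: real^'d"
  have sub: "box ?a ?b \<subseteq> cell t z" "cell t z \<subseteq> cbox ?a ?b"
    unfolding cell_def by (auto simp: mem_box_cart less_imp_le)
  \<comment> \<open>The cell lies between the open and the closed box, so it differs from the latter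
    only within the frontier.\<close>
  have neg: "negligible (cbox ?a ?b - cell t z \<union> (cell t z - cbox ?a ?b))"
    by (rule negligible_subset[OF negligible_frontier_interval[of ?a ?b]]) (use sub in auto)
  show "cell t z \<in> lmeasurable"
    by (rule lmeasurable_negligible_symdiff[OF _ neg]) simp
  have "measure lebesgue (cell t z) = measure lebesgue (cbox ?a ?b)"
    by (rule measure_negligible_symdiff[OF _ neg]) simp
  also have "\<dots> = (\<Prod>l\<in>UNIV. ?b $ l - ?a $ l)"
  proof -
    have "cbox ?a ?b \<noteq> {}"
      using t by (auto simp: interval_ne_empty_cart algebra_simps less_imp_le)
    then show ?thesis by (simp add: content_cbox_cart)
  qed
  also have "\<dots> = (\<Prod>l\<in>UNIV. of_int (t $ l))" by (simp add: algebra_simps)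
  finally show "measure lebesgue (cell t z) = (\<Prod>l\<in>UNIV. of_int (t $ l))" .
qed

lemma corner_in_cell: "(\<And>l. t $ l > 0) \<Longrightarrow> (\<chi> l. of_int (t $ l * z $ l)) \<in> cell t z"
  unfolding cell_def by (auto simp: algebra_simps)

section \<open>Cell counts compared with volume and with lattice points\<close>

definition hit_cells :: "(real^'d) set \<Rightarrow> int^'d \<Rightarrow> (int^'d) set" where
  "hit_cells S t = {z. cell t z \<inter> S \<noteq> {}}"

definition inner_cells :: "(real^'d) set \<Rightarrow> int^'d \<Rightarrow> (int^'d) set" where
  "inner_cells S t = {z. cell t z \<subseteq> S}"

lemma inner_cells_subset_hits: "(\<And>l. t $ l > 0) \<Longrightarrow> inner_cells S t \<subseteq> hit_cells S t"
  unfolding inner_cells_def hit_cells_def using corner_in_cell by blast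

lemma cell_cover:
  assumes t: "\<And>l. t $ l > 0"
  obtains z where "y \<in> cell t z"
proof
  show "y \<in> cell t (\<chi> l. \<lfloor>y $ l / of_int (t $ l)\<rfloor>)"
    unfolding cell_def
  proof (clarsimp, intro conjI)
    fix l
    have p: "real_of_int (t $ l) > 0" using t by simp
    show "of_int (t $ l) * of_int \<lfloor>y $ l / of_int (t $ l)\<rfloor> \<le> y $ l"
      by (subst mult.commute, rule pos_le_divide_eq[OF p, THEN iffD1]) simp
    show "y $ l < of_int (t $ l) * (of_int \<lfloor>y $ l / of_int (t $ l)\<rfloor> + 1)"
      by (subst mult.commute, rule pos_divide_less_eq[OF p, THEN iffD1]) linarith
  qed
qed

text \<open>Inner cells are disjoint subsets of \<open>S\<close>, hit cells cover \<open>S\<close>,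
  and all have volume \<open>V\<close>.\<close>

lemma volume_bounds:
  fixes S :: "(real^'d) set" and t :: "int^'d"
  assumes t: "\<And>l. t $ l > 0" and fin: "finite (hit_cells S t)" and S: "S \<in> lmeasurable"
  defines "V \<equiv> (\<Prod>l\<in>UNIV. of_int (t $ l))"
  shows "real (card (inner_cells S t)) * V \<le> measure lebesgue S"
    and "measure lebesgue S \<le> real (card (hit_cells S t)) * V"
proof -
  have fin': "finite (inner_cells S t)" using inner_cells_subset_hits[OF t] fin finite_subset by blast
  have "real (card (inner_cells S t)) * V = (\<Sum>z\<in>inner_cells S t. measure lebesgue (cell t z))"
    by (simp add: cell_measure[OF t] V_def)
  also have "\<dots> = measure lebesgue (\<Union>z\<in>inner_cells S t. cell t z)"
  proof (intro measure_UNION'[symmetric] fin' cell_measure t)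
    show "pairwise (\<lambda>z w. disjnt (cell t z) (cell t w)) (inner_cells S t)"
      unfolding pairwise_def disjnt_def using cell_disjoint by blast
  qed
  also have "\<dots> \<le> measure lebesgue S"
    using fin' cell_measure[OF t] S
    by (intro measure_mono_fmeasurable) (auto simp: inner_cells_def intro: fmeasurableD sets.finite_UN)
  finally show "real (card (inner_cells S t)) * V \<le> measure lebesgue S" .
  have "measure lebesgue S \<le> measure lebesgue (\<Union>z\<in>hit_cells S t. cell t z)"
  proof (rule measure_mono_fmeasurable)
    show "S \<subseteq> (\<Union>z\<in>hit_cells S t. cell t z)"
    proof
      fix y assume "y \<in> S"
      moreover obtain z where "y \<in> cell t z" using cell_cover[OF t] by blast
      ultimately show "y \<in> (\<Union>z\<in>hit_cells S t. cell t z)" unfolding hit_cells_def by auto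
    qed
  qed (use fin cell_measure[OF t] S in \<open>auto intro: fmeasurableD fmeasurable.finite_UN\<close>)
  also have "\<dots> \<le> (\<Sum>z\<in>hit_cells S t. measure lebesgue (cell t z))"
    using fin cell_measure[OF t] by (intro measure_UNION_le) (auto intro: fmeasurableD)
  also have "\<dots> = real (card (hit_cells S t)) * V" by (simp add: cell_measure[OF t] V_def)
  finally show "measure lebesgue S \<le> real (card (hit_cells S t)) * V" .
qed

lemma blocks_inner_subset: "(\<Union>z\<in>inner_cells S t. block t t z) \<subseteq> lattice_points S"
  unfolding lattice_points_cell[symmetric] inner_cells_def lattice_points_def by blast

lemma subset_blocks_hits:
  assumes t: "\<And>l. t $ l > 0"
  shows "lattice_points S \<subseteq> (\<Union>z\<in>hit_cells S t. block t t z)"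
proof
  fix v assume v: "v \<in> lattice_points S"
  obtain z where "to_R v \<in> cell t z" using cell_cover[OF t] by blast
  with v show "v \<in> (\<Union>z\<in>hit_cells S t. block t t z)"
    unfolding lattice_points_cell[symmetric] hit_cells_def lattice_points_def by blast
qed

text \<open>The same sandwich as for the volume, because a block holds exactly \<open>V\<close>
  lattice points. Comparing the two ties the cardinality of \<open>D n\<close> to the volume of
  \<open>C n\<close>.\<close>

lemma lattice_bounds:
  fixes S :: "(real^'d) set" and t :: "int^'d"
  assumes t: "\<And>l. t $ l > 0" and fin: "finite (hit_cells S t)"
  defines "V \<equiv> (\<Prod>l\<in>UNIV. of_int (t $ l))"
  shows "finite (lattice_points S)"
    and "real (card (inner_cells S t)) * V \<le> real (card (lattice_points S))"
    and "real (card (lattice_points S)) \<le> real (card (hit_cells S t)) * V"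
proof -
  have fin': "finite (inner_cells S t)" using inner_cells_subset_hits[OF t] fin finite_subset by blast
  have V: "V = real (card (block t t z))" for z
    unfolding card_block V_def using t by (simp add: less_imp_le)
  show fl: "finite (lattice_points S)"
    by (rule finite_subset[OF subset_blocks_hits[OF t]]) (use fin in auto)
  have "real (card (inner_cells S t)) * V = real (\<Sum>z\<in>inner_cells S t. card (block t t z))"
    by (simp add: V[symmetric])
  also have "(\<Sum>z\<in>inner_cells S t. card (block t t z)) = card (\<Union>z\<in>inner_cells S t. block t t z)"
    using fin' block_disjoint by (intro card_UN_disjoint[symmetric]) auto
  also have "\<dots> \<le> card (lattice_points S)"
    by (intro card_mono fl blocks_inner_subset)
  finally show "real (card (inner_cells S t)) * V \<le> real (card (lattice_points S))" by simp
  have "card (lattice_points S) \<le> card (\<Union>z\<in>hit_cells S t. block t t z)"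
    by (intro card_mono subset_blocks_hits t) (use fin in auto)
  also have "\<dots> \<le> (\<Sum>z\<in>hit_cells S t. card (block t t z))" by (rule card_UN_le[OF fin])
  finally have "real (card (lattice_points S)) \<le> real (\<Sum>z\<in>hit_cells S t. card (block t t z))"
    unfolding of_nat_le_iff .
  also have "\<dots> = real (card (hit_cells S t)) * V" by (simp add: V[symmetric])
  finally show "real (card (lattice_points S)) \<le> real (card (hit_cells S t)) * V" .
qed

section \<open>Boundary cells of unions of convex bodies\<close>

definition last_cells :: "(real^'d) set \<Rightarrow> int^'d \<Rightarrow> 'd \<Rightarrow> int \<Rightarrow> (int^'d) set" where
  "last_cells S t l s = {z \<in> hit_cells S t. \<forall>j\<ge>int CARD('d). z + axis l (s * j) \<notin> hit_cells S t}"

text \<open>Two such cells on one line in direction \<open>l\<close> are less than d apart, d being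
  the dimension, since otherwise the further one violates the condition on the other. Hence residues
  modulo d tell them apart, giving at most d per line, and at most (2N+1)^(d-1) lines occur.\<close>

lemma card_last_cells:
  fixes S :: "(real^'d) set"
  assumes hit_cells: "hit_cells S t \<subseteq> {z. \<forall>l. \<bar>z $ l\<bar> \<le> int N}" and s: "s = 1 \<or> s = -1"
  shows "card (last_cells S t l s) \<le> CARD('d) * (2 * N + 1) ^ (CARD('d) - 1)"
proof -
  let ?d = "int CARD('d)"
  \<comment> \<open>The first component names the line through \<open>z\<close>, the second the
    residue of the position on it.\<close>
  let ?f = "\<lambda>z :: int^'d. (z - axis l (z $ l), z $ l mod ?d)"
  let ?b = "(\<chi> i. if i = l then 0 else int N) :: int^'d"
  let ?B = "{z. \<forall>i. (- ?b) $ i \<le> z $ i \<and> z $ i \<le> ?b $ i}"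
  have key: "z $ l = w $ l"
    if z: "z \<in> last_cells S t l s" and w: "w \<in> last_cells S t l s"
      and le: "s * z $ l \<le> s * w $ l"
      and eq: "z - axis l (z $ l) = w - axis l (w $ l)" and md: "z $ l mod ?d = w $ l mod ?d" for z w
  proof (rule ccontr)
    assume ne: "z $ l \<noteq> w $ l"
    \<comment> \<open>The number of steps from \<open>z\<close> to \<open>w\<close> in direction
      \<open>s\<close>: positive and divisible by d, hence at least d.\<close>
    define j where "j = s * (w $ l - z $ l)"
    have "?d dvd w $ l - z $ l" using md by (metis mod_eq_dvd_iff)
    then have "?d dvd j" by (simp add: j_def)
    moreover have "j > 0" using le ne s by (auto simp: j_def)
    ultimately have "?d \<le> j" by (rule zdvd_imp_le)
    moreover have "w = z + axis l (s * j)"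
    proof -
      have 1: "s * j = w $ l - z $ l" using s by (auto simp: j_def)
      have 2: "axis l (w $ l - z $ l) = axis l (w $ l) - axis l (z $ l)"
        by (auto simp: vec_eq_iff axis_def)
      show ?thesis unfolding 1 2 using eq by (simp add: algebra_simps)
    qed
    moreover have "w \<in> hit_cells S t" "\<forall>j\<ge>?d. z + axis l (s * j) \<notin> hit_cells S t"
      using z w by (simp_all add: last_cells_def)
    ultimately show False by metis
  qed
  have inj: "inj_on ?f (last_cells S t l s)"
  proof (rule inj_onI)
    fix z w assume zw: "z \<in> last_cells S t l s" "w \<in> last_cells S t l s" "?f z = ?f w"
    then have e: "z - axis l (z $ l) = w - axis l (w $ l)" "z $ l mod ?d = w $ l mod ?d"
      by (simp_all only: prod.inject)
    have "z $ l = w $ l"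
      using key[OF zw(1,2) _ e] key[OF zw(2,1) _ e[symmetric]] by (metis linear)
    with e show "z = w" by simp
  qed
  have img: "?f ` last_cells S t l s \<subseteq> ?B \<times> {0..<?d}"
  proof -
    have "- int N \<le> z $ i \<and> z $ i \<le> int N" if "z \<in> last_cells S t l s" for z i
    proof -
      have "\<bar>z $ i\<bar> \<le> int N" using that hit_cells unfolding last_cells_def by blast
      then show ?thesis by linarith
    qed
    then show ?thesis by (auto simp: axis_def)
  qed
  have "card (last_cells S t l s) \<le> card (?B \<times> {0..<?d})"
    by (rule card_inj_on_le[OF inj img]) (intro finite_cartesian_product finite_int_box, simp)
  also have "\<dots> = CARD('d) * card ?B" by (simp add: card_cartesian_product)
  also have "card ?B = (\<Prod>i\<in>UNIV. nat (?b $ i - (- ?b) $ i + 1))" by (rule card_int_box)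
  also have "\<dots> = (\<Prod>i\<in>UNIV. if i = l then 1 else 2 * N + 1)"
    by (intro prod.cong) auto
  also have "\<dots> = (2 * N + 1) ^ (CARD('d) - 1)"
    by (simp add: prod.If_cases Compl_eq_Diff_UNIV)
  finally show ?thesis .
qed

text \<open>A supporting half-space at a point of \<open>cell t z - S\<close> shows that \<open>S\<close> ends at most \<open>d - 1\<close>
  cells beyond \<open>z\<close> in the coordinate direction in which its scaled normal is largest.\<close>

lemma boundary_cell_last:
  fixes S :: "(real^'d) set"
  assumes t: "\<And>l. t $ l > 0" and S: "convex S" "closed S"
    and z: "z \<in> hit_cells S t - inner_cells S t"
  shows "\<exists>l. z \<in> last_cells S t l 1 \<or> z \<in> last_cells S t l (-1)"
proof -
  obtain y where y: "y \<in> cell t z" "y \<notin> S" using z by (auto simp: inner_cells_def)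
  obtain a b where ab: "a \<bullet> y < b" "\<And>x. x \<in> S \<Longrightarrow> b < a \<bullet> x"
    using separating_hyperplane_closed_point[OF S y(2)] by blast
  \<comment> \<open>The most that coordinate \<open>l\<close> can change the product with
    \<open>a\<close> between two points of one cell.\<close>
  define g where "g l = \<bar>a $ l\<bar> * of_int (t $ l)" for l
  obtain l where l: "\<And>i. g i \<le> g l"
  proof -
    have "Max (range g) \<in> range g" by (rule Max_in) auto
    then obtain l where "Max (range g) = g l" by blast
    moreover have "g i \<le> Max (range g)" for i by (rule Max_ge) auto
    ultimately have "g i \<le> g l" for i by metis
    then show ?thesis using that by blast
  qed
  \<comment> \<open>\<open>S\<close> lies where the product with \<open>a\<close> is large, so cells
    are followed in the direction in which it decreases. If \<open>a $ l = 0\<close>, then all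
    \<open>g i\<close> vanish and either sign serves.\<close>
  define s :: int where "s = (if a $ l > 0 then -1 else 1)"
  have "z + axis l (s * j) \<notin> hit_cells S t" if j: "j \<ge> int CARD('d)" for j
  proof
    assume "z + axis l (s * j) \<in> hit_cells S t"
    then obtain w where w: "w \<in> cell t (z + axis l (s * j))" "w \<in> S" by (auto simp: hit_cells_def)
    have "a \<bullet> w - a \<bullet> y = (\<Sum>i\<in>UNIV. a $ i * (w $ i - y $ i))"
      by (simp add: inner_vec_def algebra_simps sum_subtractf)
    \<comment> \<open>Each of the d coordinates can gain at most \<open>g l\<close> from the
      positions within the cells, while the move by \<open>j\<close> cells loses
      \<open>j * g l\<close>. This is where the threshold \<open>j \<ge> d\<close> comes
      from.\<close>
    also have "\<dots> \<le> (\<Sum>i\<in>UNIV. g l - (if i = l then of_int j * g l else 0))"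
    proof (rule sum_mono)
      fix i
      let ?e = "if i = l then of_int (t $ l) * of_int (s * j) else (0 :: real)"
      have "of_int (t $ i * z $ i) \<le> y $ i \<and> y $ i < of_int (t $ i * (z $ i + 1))"
        using y(1) unfolding cell_def by blast
      moreover have "of_int (t $ i * (z + axis l (s * j)) $ i) \<le> w $ i
          \<and> w $ i < of_int (t $ i * ((z + axis l (s * j)) $ i + 1))"
        using w(1) unfolding cell_def by blast
      moreover have "of_int (t $ i * (z + axis l (s * j)) $ i) = of_int (t $ i * z $ i) + ?e"
        by (simp add: axis_def algebra_simps)
      ultimately have "of_int (t $ i * z $ i) \<le> y $ i" "y $ i < of_int (t $ i * z $ i) + of_int (t $ i)"
        "of_int (t $ i * z $ i) + ?e \<le> w $ i" "w $ i < of_int (t $ i * z $ i) + ?e + of_int (t $ i)"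
        by (simp_all only: distrib_left of_int_add mult_1_right)
      then have "\<bar>w $ i - y $ i - ?e\<bar> \<le> of_int (t $ i)" by (simp only: abs_le_iff) linarith
      then have "\<bar>a $ i\<bar> * \<bar>w $ i - y $ i - ?e\<bar> \<le> g i"
        unfolding g_def by (rule mult_left_mono) simp
      then have "a $ i * (w $ i - y $ i - ?e) \<le> g i"
        using abs_ge_self[of "a $ i * (w $ i - y $ i - ?e)"] by (simp only: abs_mult)
      then have "a $ i * (w $ i - y $ i) \<le> g i + a $ i * ?e" by (simp add: algebra_simps)
      also have "a $ i * ?e = - (if i = l then of_int j * g l else 0)"
        by (auto simp: s_def g_def)
      finally show "a $ i * (w $ i - y $ i) \<le> g l - (if i = l then of_int j * g l else 0)"
        using l[of i] by simp
    qed
    also have "\<dots> = (real CARD('d) - of_int j) * g l"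
      by (simp add: sum_subtractf algebra_simps)
    also have "\<dots> \<le> 0"
    proof -
      have "real CARD('d) \<le> of_int j" using j by linarith
      moreover have "0 \<le> g l" unfolding g_def using t[of l] by simp
      ultimately show ?thesis by (simp add: mult_nonpos_nonneg)
    qed
    finally show False using ab(1) ab(2)[OF w(2)] by simp
  qed
  then have "z \<in> last_cells S t l s" using z by (auto simp: last_cells_def)
  then show ?thesis unfolding s_def by (metis (full_types))
qed

text \<open>The factor 2 d^2 collects d axes, two directions on each, and d last cells per
  line.\<close>

lemma card_boundary_convex:
  fixes S :: "(real^'d) set"
  assumes t: "\<And>l. t $ l > 0" and S: "convex S" "closed S"
    and hit_cells: "hit_cells S t \<subseteq> {z. \<forall>l. \<bar>z $ l\<bar> \<le> int N}"
  shows "card (hit_cells S t - inner_cells S t) \<le> 2 * CARD('d)\<^sup>2 * (2 * N + 1) ^ (CARD('d) - 1)"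
proof -
  have fin: "finite (hit_cells S t)"
    by (rule finite_subset[OF hit_cells])
       (use finite_int_box[of "\<chi> l. - int N" "\<chi> l. int N"] in \<open>simp add: abs_le_iff minus_le_iff conj_commute\<close>)
  let ?P = "UNIV \<times> {1, -1} :: ('d \<times> int) set"
  let ?L = "\<lambda>(l, s). last_cells S t l s"
  have fL: "finite (?L p)" for p
    by (rule finite_subset[OF _ fin]) (auto simp: last_cells_def split: prod.splits)
  have "hit_cells S t - inner_cells S t \<subseteq> (\<Union>p\<in>?P. ?L p)"
    using boundary_cell_last[OF t S] by fastforce
  then have "card (hit_cells S t - inner_cells S t) \<le> card (\<Union>p\<in>?P. ?L p)"
    using fL by (intro card_mono) auto
  also have "\<dots> \<le> (\<Sum>p\<in>?P. card (?L p))" by (intro card_UN_le) simp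
  also have "\<dots> \<le> (\<Sum>p\<in>?P. CARD('d) * (2 * N + 1) ^ (CARD('d) - 1))"
    by (intro sum_mono) (use card_last_cells[OF hit_cells] in auto)
  also have "\<dots> = 2 * CARD('d)\<^sup>2 * (2 * N + 1) ^ (CARD('d) - 1)"
    by (simp add: card_cartesian_product power2_eq_square)
  finally show ?thesis .
qed

lemma card_boundary_p_convex:
  fixes S :: "(real^'d) set"
  assumes t: "\<And>l. t $ l > 0" and S: "p_convex p S"
    and hit_cells: "hit_cells S t \<subseteq> {z. \<forall>l. \<bar>z $ l\<bar> \<le> int N}"
  shows "card (hit_cells S t - inner_cells S t) \<le> p * (2 * CARD('d)\<^sup>2 * (2 * N + 1) ^ (CARD('d) - 1))"
proof -
  obtain B where B: "\<And>i. i < p \<Longrightarrow> convex_body (B i)" and S_eq: "S = (\<Union>i<p. B i)"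
    using S by (auto simp: p_convex_def)
  have hB: "hit_cells (B i) t \<subseteq> {z. \<forall>l. \<bar>z $ l\<bar> \<le> int N}" if "i < p" for i
    using hit_cells that by (force simp: hit_cells_def S_eq)
  have fB: "finite (hit_cells (B i) t)" if "i < p" for i
    by (rule finite_subset[OF hB[OF that]])
       (use finite_int_box[of "\<chi> l. - int N" "\<chi> l. int N"] in \<open>simp add: abs_le_iff minus_le_iff conj_commute\<close>)
  \<comment> \<open>A cell hit by \<open>S\<close> is hit by some \<open>B i\<close>; were it
    contained in that \<open>B i\<close>, it would be contained in \<open>S\<close>.\<close>
  have "hit_cells S t - inner_cells S t \<subseteq> (\<Union>i<p. hit_cells (B i) t - inner_cells (B i) t)"
    unfolding hit_cells_def inner_cells_def S_eq by blast
  then have "card (hit_cells S t - inner_cells S t) \<le> card (\<Union>i<p. hit_cells (B i) t - inner_cells (B i) t)"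
    using fB by (intro card_mono) auto
  also have "\<dots> \<le> (\<Sum>i<p. card (hit_cells (B i) t - inner_cells (B i) t))" by (intro card_UN_le) simp
  also have "\<dots> \<le> (\<Sum>i<p. 2 * CARD('d)\<^sup>2 * (2 * N + 1) ^ (CARD('d) - 1))"
    by (intro sum_mono card_boundary_convex t hB)
       (use B in \<open>auto simp: convex_body_def intro: compact_imp_closed\<close>)
  finally show ?thesis by simp
qed

lemma p_convex_lmeasurable: "p_convex p S \<Longrightarrow> S \<in> lmeasurable"
  by (auto simp: p_convex_def convex_body_def intro!: fmeasurable.finite_UN lmeasurable_compact)

section \<open>Separation of cores and neighbourhoods of blocks\<close>

text \<open>A vector of the unit ball has coordinates of modulus at most 1, so scaling by
  \<open>g\<close> displaces coordinate \<open>l\<close> by less than \<open>t $ l - s $ l\<close>.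
  Cores with different indices differ in some coordinate by more than this.\<close>

lemma separated_cores:
  fixes t s g :: "_^'d"
  assumes g: "\<And>l. \<bar>g $ l\<bar> < of_int (t $ l - s $ l)" and t: "\<And>l. 0 < t $ l" and z: "z \<notin> Y"
  shows "separated g (\<Union>y\<in>Y. block t s y) (block t s z)"
  unfolding separated_def
proof (rule ccontr)
  assume "\<not> to_R ` block t s z \<subseteq> - (to_R ` (\<Union>y\<in>Y. block t s y) + scale g (cball 0 1))"
  then obtain v w y u where v: "v \<in> block t s z" and y: "y \<in> Y" and w: "w \<in> block t s y"
    and u: "u \<in> cball 0 1" and eq: "to_R v = to_R w + g * u"
    by (fastforce simp: set_plus_def scale_def)
  have "y \<noteq> z" using y z by auto
  then obtain l where l: "y $ l \<noteq> z $ l" by (auto simp: vec_eq_iff)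
  have "\<bar>u $ l\<bar> \<le> 1" using u component_le_norm_cart[of u l] by simp
  then have "\<bar>g $ l\<bar> * \<bar>u $ l\<bar> \<le> \<bar>g $ l\<bar>" by (simp add: mult_left_le)
  moreover have "\<bar>g $ l\<bar> * \<bar>u $ l\<bar> = \<bar>real_of_int (v $ l) - of_int (w $ l)\<bar>"
    using arg_cong[OF eq, of "\<lambda>x. x $ l"] by (simp add: to_R_def abs_mult)
  ultimately have "\<bar>real_of_int (v $ l) - of_int (w $ l)\<bar> < of_int (t $ l - s $ l)"
    using g[of l] by linarith
  then have lt: "\<bar>v $ l - w $ l\<bar> < t $ l - s $ l" by linarith
  have vw: "t $ l * z $ l \<le> v $ l" "v $ l < t $ l * z $ l + s $ l"
    "t $ l * y $ l \<le> w $ l" "w $ l < t $ l * y $ l + s $ l"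
    using v w by (auto simp: block_def)
  have "y $ l + 1 \<le> z $ l \<or> z $ l + 1 \<le> y $ l" using l by linarith
  then have "t $ l * (y $ l + 1) \<le> t $ l * z $ l \<or> t $ l * (z $ l + 1) \<le> t $ l * y $ l"
    using t[of l] by (auto intro: mult_left_mono)
  then show False using vw lt by (auto simp: algebra_simps)
qed

definition nbr_cube :: "(int^'d) set" where
  "nbr_cube = {z. \<forall>l. (- 1) $ l \<le> z $ l \<and> z $ l \<le> 1 $ l}"

lemma nbr_cube_finite [simp]: "finite nbr_cube"
  unfolding nbr_cube_def by (rule finite_int_box)

text \<open>A coordinate in [0, t) moved by at most t stays in [-t, 2t), which is made up of three
  consecutive grid intervals.\<close>

lemma nbr_cube_cover:
  fixes t v w :: "int^'d"
  assumes t: "\<And>l. t $ l > 0" and v: "v \<in> block t t 0" and w: "\<And>l. \<bar>w $ l - v $ l\<bar> \<le> t $ l"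
  shows "w \<in> block t t 0 \<union> (\<Union>z\<in>nbr_cube - {0}. block t t z)"
proof -
  obtain z where "to_R w \<in> cell t z" using cell_cover[OF t] by blast
  then have wz: "w \<in> block t t z"
    unfolding lattice_points_cell[symmetric] lattice_points_def by simp
  have "- 1 \<le> z $ l \<and> z $ l \<le> 1" for l
  proof -
    have *: "0 \<le> v $ l" "v $ l < t $ l" "t $ l * z $ l \<le> w $ l" "w $ l < t $ l * z $ l + t $ l"
      using v wz by (auto simp: block_def)
    have "t $ l * z $ l < t $ l * 2" "t $ l * (-2) < t $ l * z $ l" using * w[of l] by linarith+
    then have "z $ l < 2" "-2 < z $ l" using t[of l] by (simp_all only: mult_less_cancel_left_pos)
    then show ?thesis by linarith
  qed
  then have "z \<in> nbr_cube" by (simp add: nbr_cube_def)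
  with wz show ?thesis by (cases "z = 0") auto
qed

section \<open>Integer form of the windows, blocks and index sets\<close>

definition tint :: "real^'d \<Rightarrow> nat \<Rightarrow> int^'d" where
  "tint c k = (\<chi> l. \<lfloor>c $ l / k_root TYPE('d) k\<rfloor>)"

lemma tvec_eq: "tvec c k = to_R (tint c k)"
  by (simp add: tvec_def tint_def to_R_def vec_eq_iff)

lemma scale_unit_cell:
  fixes t z :: "int^'d"
  assumes t: "\<And>l. t $ l > 0"
  shows "scale (to_R t) ({to_R z} + {x. \<forall>l. 0 \<le> x $ l \<and> x $ l < 1}) = cell t z"
proof (intro equalityI subsetI)
  fix y assume "y \<in> scale (to_R t) ({to_R z} + {x. \<forall>l. 0 \<le> x $ l \<and> x $ l < 1})"
  then obtain u where u: "\<And>l. 0 \<le> u $ l" "\<And>l. u $ l < 1" and y: "y = to_R t * (to_R z + u)"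
    by (auto simp: scale_def set_plus_def)
  have "0 \<le> of_int (t $ l) * u $ l \<and> of_int (t $ l) * u $ l < of_int (t $ l)" for l
    using u[of l] t[of l] by simp
  then show "y \<in> cell t z" by (simp add: y cell_def to_R_def algebra_simps)
next
  fix y assume y: "y \<in> cell t z"
  \<comment> \<open>The relative position of \<open>y\<close> within its cell.\<close>
  define u :: "real^'d" where "u = (\<chi> l. y $ l / of_int (t $ l) - of_int (z $ l))"
  have yl: "of_int (t $ l) * of_int (z $ l) \<le> y $ l" "y $ l < of_int (t $ l) * (of_int (z $ l) + 1)" for l
    using y by (simp_all add: cell_def)
  have tp: "0 < real_of_int (t $ l)" for l using t by simp
  have "of_int (z $ l) \<le> y $ l / of_int (t $ l)" for l
    by (subst pos_le_divide_eq[OF tp]) (use yl[of l] in \<open>simp add: mult.commute\<close>)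
  moreover have "y $ l / of_int (t $ l) < of_int (z $ l) + 1" for l
    by (subst pos_divide_less_eq[OF tp]) (use yl[of l] in \<open>simp add: mult.commute\<close>)
  ultimately have "0 \<le> u $ l \<and> u $ l < 1" for l by (simp add: u_def) (metis add.commute less_diff_eq diff_less_eq)
  moreover have "y = to_R t * (to_R z + u)"
    unfolding u_def to_R_def vec_eq_iff using t by (simp add: less_imp_neq[THEN not_sym])
  ultimately show "y \<in> scale (to_R t) ({to_R z} + {x. \<forall>l. 0 \<le> x $ l \<and> x $ l < 1})"
    unfolding scale_def set_plus_def by blast
qed

lemma scale_sym_cube:
  assumes c: "\<And>l. 0 < c $ l"
  shows "scale c (sym_cube b) = {y. \<forall>l. \<bar>y $ l\<bar> \<le> b * c $ l}"
proof (intro equalityI subsetI)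
  fix y assume "y \<in> scale c (sym_cube b)"
  then obtain u where "u \<in> sym_cube b" and y: "y = c * u"
    unfolding scale_def by blast
  then have u: "\<bar>u $ l\<bar> \<le> b" for l
    by (auto simp: sym_cube_def mem_box_cart abs_le_iff minus_le_iff)
  have "\<bar>c $ l * u $ l\<bar> \<le> b * c $ l" for l
    using u[of l] c[of l] by (simp add: abs_mult)
  then show "y \<in> {y. \<forall>l. \<bar>y $ l\<bar> \<le> b * c $ l}" by (simp add: y)
next
  fix y assume y: "y \<in> {y. \<forall>l. \<bar>y $ l\<bar> \<le> b * c $ l}"
  have "- b \<le> y $ l / c $ l \<and> y $ l / c $ l \<le> b" for l
    using y c[of l] by (auto simp: pos_divide_le_eq pos_le_divide_eq abs_le_iff minus_le_iff)
  then have "(\<chi> l. y $ l / c $ l) \<in> sym_cube b"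
    by (simp add: sym_cube_def mem_box_cart)
  moreover have "y = c * (\<chi> l. y $ l / c $ l)"
    using c by (simp add: vec_eq_iff less_imp_neq[THEN not_sym])
  ultimately show "y \<in> scale c (sym_cube b)" unfolding scale_def by blast
qed

lemma I_block_eq: "(\<And>l. tint c k $ l > 0) \<Longrightarrow> I_block c k z = cell (tint c k) z"
  unfolding I_block_def tvec_eq by (rule scale_unit_cell)

lemma D_plus_eq:
  assumes "\<And>l. tint c k $ l > 0"
  shows "D_plus C c k = (\<Union>z\<in>hit_cells C (tint c k). block (tint c k) (tint c k) z)"
  unfolding D_plus_def J_block_def hit_cells_def I_block_eq[OF assms] lattice_points_cell by blast

lemma K_set_eq:
  "(\<And>l. 0 < c $ l) \<Longrightarrow> K_set b c = {v. \<forall>l. \<bar>of_int (v $ l)\<bar> \<le> b * c $ l}"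
  by (simp add: K_set_def scale_sym_cube lattice_points_def to_R_def)

definition future :: "(int^'d) rel \<Rightarrow> int^'d \<Rightarrow> (int^'d) set" where
  "future R t = {z. (\<forall>l. \<bar>z $ l\<bar> \<le> t $ l) \<and> (0, z) \<in> R - Id}"

lemma A_set_eq:
  assumes "\<And>l. tint c k $ l > 0"
  shows "A_set R c k 0 = future R (tint c k)"
proof -
  have [simp]: "to_R 0 = (0 :: real^'d)" by (simp add: to_R_def vec_eq_iff)
  have "scale (to_R (tint c k)) (sym_cube 1) = {y. \<forall>l. \<bar>y $ l\<bar> \<le> of_int (tint c k $ l)}"
    by (subst scale_sym_cube) (use assms in \<open>auto simp: to_R_def\<close>)
  then show ?thesis
    unfolding A_set_def future_def tvec_eq lattice_points_def \<open>to_R 0 = 0\<close>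
    by (simp only: mem_Collect_eq set_zero[symmetric] add_0) (auto simp: to_R_def simp flip: of_int_abs)
qed

lemma finite_future [simp]: "finite (future R t)"
  by (rule finite_subset[OF _ finite_int_box[of "- t" t]]) (auto simp: future_def abs_le_iff minus_le_iff)

text \<open>The order is assumed invariant in one direction only; the converse is translation by
  \<open>- v\<close>.\<close>

lemma order_translate:
  assumes "translation_invariant_total_order R"
  shows "(v, v + z) \<in> R - Id \<longleftrightarrow> (0, z) \<in> R - Id"
proof -
  have inv: "(u, w) \<in> R \<Longrightarrow> (u + y, w + y) \<in> R" for u w y
    using assms by (auto simp: translation_invariant_total_order_def)
  show ?thesis using inv[of 0 z v] inv[of v "v + z" "- v"] by (auto simp: add.commute)
qed

lemma future_translate:
  assumes "translation_invariant_total_order R"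
  shows "(+) v ` future R t = {w. (\<forall>l. \<bar>w $ l - v $ l\<bar> \<le> t $ l) \<and> (v, w) \<in> R - Id}" (is "_ = ?B")
proof (intro equalityI subsetI)
  fix w assume w: "w \<in> ?B"
  have "w - v \<in> future R t"
    using w order_translate[OF assms, of v "w - v"] by (auto simp: future_def)
  then show "w \<in> (+) v ` future R t" by (metis add_diff_cancel_left' diff_add_cancel add.commute image_eqI)
qed (use order_translate[OF assms] in \<open>auto simp: future_def\<close>)

section \<open>Bounds by block cores\<close>

context level_field
begin

text \<open>The inequality of condition D at one fixed index, rewritten with
  \<open>le_prob\<close>.\<close>

definition mixing :: "(int^'d) set \<Rightarrow> real^'d \<Rightarrow> real \<Rightarrow> bool" where
  "mixing K g \<alpha> \<longleftrightarrow> (\<forall>A B. A \<subseteq> K \<and> B \<subseteq> K \<and> separated g A B \<and> (is_box A \<or> is_box B) \<longrightarrow>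
     \<bar>le_prob (A \<union> B) - le_prob A * le_prob B\<bar> \<le> \<alpha>)"

text \<open>Condition D does not state a sign for its constants; applying it to two empty sets
  supplies one.\<close>

lemma mixing_nonneg:
  assumes "mixing K g \<alpha>"
  shows "0 \<le> \<alpha>"
proof -
  \<comment> \<open>A lower corner 1 above the upper corner 0 presents the empty set as a
    box.\<close>
  have "is_box ({} :: (int^'d) set)" unfolding is_box_def
    by (rule exI[of _ 1], rule exI[of _ 0]) auto
  then have "\<bar>le_prob ({} \<union> {}) - le_prob {} * le_prob {}\<bar> \<le> \<alpha>"
    using assms unfolding mixing_def separated_def by blast
  then show ?thesis by linarith
qed

lemma block_prob: "le_prob (block t s z) = le_prob (block t s 0)"
  by (subst block_shift) (simp add: le_prob_shift)

text \<open>Cores are split off one by one. The one split off is the box that condition D requires,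
  its partner is the union of those chosen before, and stationarity makes all factors equal.\<close>

lemma core_product:
  assumes mix: "mixing K g \<alpha>" and Z: "finite Z" and t: "\<And>l. 0 < t $ l"
    and g: "\<And>l. \<bar>g $ l\<bar> < of_int (t $ l - s $ l)"
    and K: "\<And>z. z \<in> Z \<Longrightarrow> block t s z \<subseteq> K"
  shows "\<bar>le_prob (\<Union>z\<in>Z. block t s z) - le_prob (block t s 0) ^ card Z\<bar> \<le> real (card Z) * \<alpha>"
proof -
  have "\<bar>le_prob (\<Union>z\<in>Z. block t s z) - (\<Prod>z\<in>Z. le_prob (block t s z))\<bar> \<le> real (card Z) * \<alpha>"
  proof (rule le_prob_UN_prod[OF Z mixing_nonneg[OF mix]])
    fix Y z assume Yz: "Y \<subseteq> Z" "z \<in> Z - Y"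
    have "(\<Union>y\<in>Y. block t s y) \<subseteq> K" "block t s z \<subseteq> K" using K Yz by auto
    moreover have "separated g (\<Union>y\<in>Y. block t s y) (block t s z)"
      using Yz by (intro separated_cores[OF g t]) auto
    ultimately show "\<bar>le_prob ((\<Union>y\<in>Y. block t s y) \<union> block t s z)
        - le_prob (\<Union>y\<in>Y. block t s y) * le_prob (block t s z)\<bar> \<le> \<alpha>"
      using mix is_box_block[of t s z] unfolding mixing_def by simp
  qed
  moreover have "(\<Prod>z\<in>Z. le_prob (block t s z)) = (\<Prod>z\<in>Z. le_prob (block t s 0))"
    by (intro prod.cong refl block_prob)
  ultimately show ?thesis by simp
qed

lemma core_subset:
  assumes g: "\<And>l. \<bar>g $ l\<bar> < (of_int (t $ l - s $ l) :: real)"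
  shows "block t s z \<subseteq> block t t z"
proof (rule block_mono)
  fix l have "0 < (of_int (t $ l - s $ l) :: real)" using g[of l] by linarith
  then show "s $ l \<le> t $ l" by simp
qed

text \<open>Two points of a core differ by less than \<open>t\<close> in each coordinate, so
  \<open>future R t\<close> sees every later point and \<open>exc_lower\<close> applies. Then 1 - a
  \<le> exp(-a) turns the power into an exponential.\<close>

lemma max_prob_upper:
  assumes R: "translation_invariant_total_order R"
    and mix: "mixing K g \<alpha>" and Z: "finite Z" and t: "\<And>l. 0 < t $ l"
    and g: "\<And>l. \<bar>g $ l\<bar> < of_int (t $ l - s $ l)"
    and K: "(\<Union>z\<in>Z. block t t z) \<subseteq> K" and D: "(\<Union>z\<in>Z. block t t z) \<subseteq> D" "finite D"
  shows "le_prob D \<le> exp (- (real (card Z) * real (card (block t s 0)) * last_prob (future R t)))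
    + real (card Z) * \<alpha>"
proof -
  note sub = core_subset[OF g]
  let ?W = "real (card (block t s 0))" and ?p = "last_prob (future R t)"
  have lin: "linear_order R" using R by (simp add: translation_invariant_total_order_def)
  have "?W * ?p \<le> 1 - le_prob (block t s 0)"
  proof (rule exc_lower[OF lin])
    fix v assume v: "v \<in> block t s 0"
    show "{z \<in> block t s 0. (v, z) \<in> R - Id} \<subseteq> (+) v ` future R t"
    proof
      fix z assume z: "z \<in> {z \<in> block t s 0. (v, z) \<in> R - Id}"
      then have "z \<in> block t t 0" "v \<in> block t t 0" using v sub by blast+
      then have "\<bar>z $ l - v $ l\<bar> \<le> t $ l" for l
        by (auto simp: block_def abs_le_iff intro: order_trans[OF less_imp_le]) (smt (verit))+
      then show "z \<in> (+) v ` future R t" using z unfolding future_translate[OF R] by blast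
    qed
  qed auto
  then have "le_prob (block t s 0) \<le> exp (- (?W * ?p))"
    using exp_ge_add_one_self[of "- (?W * ?p)"] by linarith
  then have "le_prob (block t s 0) ^ card Z \<le> exp (- (?W * ?p)) ^ card Z"
    by (intro power_mono) auto
  also have "\<dots> = exp (- (real (card Z) * ?W * ?p))"
    by (simp add: exp_of_nat_mult[symmetric] mult.assoc)
  finally have 1: "le_prob (block t s 0) ^ card Z \<le> exp (- (real (card Z) * ?W * ?p))" .
  have "le_prob D \<le> le_prob (\<Union>z\<in>Z. block t s z)"
    using sub D by (intro le_prob_antimono) blast+
  also have "\<dots> \<le> le_prob (block t s 0) ^ card Z + real (card Z) * \<alpha>"
  proof -
    have "block t s z \<subseteq> K" if "z \<in> Z" for z using sub K that by blast
    from core_product[OF mix Z t g this] show ?thesis by linarith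
  qed
  finally show ?thesis using 1 by linarith
qed

text \<open>Here \<open>y\<close> bounds the probability of an exceedance in one block: the main
  term counts last exceedances, the rest allows for a second exceedance in a neighbouring block. The
  two subtracted terms pay for factorising over the cores and for returning from cores to
  blocks.\<close>

lemma max_prob_lower:
  fixes t s :: "int^'d"
  assumes R: "translation_invariant_total_order R"
    and mix: "mixing K g \<alpha>" and Z: "finite Z" and t: "\<And>l. 0 < t $ l"
    and g: "\<And>l. \<bar>g $ l\<bar> < of_int (t $ l - s $ l)"
    and K: "(\<Union>z\<in>Z. block t t z) \<subseteq> K" and D: "D \<subseteq> (\<Union>z\<in>Z. block t t z)"
    and K0: "(\<Union>z\<in>nbr_cube. block t t z) \<subseteq> K"
  defines "V \<equiv> real (card (block t t 0))" and "W \<equiv> real (card (block t s 0))"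
  defines "y \<equiv> V * last_prob (future R t)
      + real (card (nbr_cube :: (int^'d) set)) * ((V * exc_prob)\<^sup>2 + \<alpha> + 2 * ((V - W) * exc_prob))"
  assumes y: "y \<le> 1"
  shows "(1 - y) ^ card Z - real (card Z) * \<alpha> - real (card Z) * ((V - W) * exc_prob) \<le> le_prob D"
proof -
  note sub = core_subset[OF g]
  have lin: "linear_order R" using R by (simp add: translation_invariant_total_order_def)
  have cardt: "real (card (block t t z)) = V" for z
    unfolding V_def card_block by simp
  have cards: "real (card (block t s z)) = W" for z
    unfolding W_def card_block by simp
  have WV: "W \<le> V" unfolding V_def W_def using sub by (simp add: card_mono)
  let ?b = "(V * exc_prob)\<^sup>2 + \<alpha> + 2 * ((V - W) * exc_prob)"
  let ?N = "\<Union>z\<in>nbr_cube - {0}. block t t z"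
  let ?J = "block t t 0"
  have pair: "\<P>(\<omega> in M. \<not> exc_free X x ?J \<omega> \<and> \<not> exc_free X x (block t t z) \<omega>) \<le> ?b"
    if z: "z \<in> nbr_cube - {0}" for z
  proof -
    let ?A = "block t s 0" and ?B = "block t s z"
    have "0 \<in> (nbr_cube :: (int^'d) set)" by (simp add: nbr_cube_def)
    then have "?A \<subseteq> K" "?B \<subseteq> K" using sub K0 z by blast+
    moreover have "separated g ?A ?B"
      using separated_cores[OF g t, of z "{0}"] z by simp
    ultimately have "\<bar>le_prob (?A \<union> ?B) - le_prob ?A * le_prob ?B\<bar> \<le> \<alpha>"
      using mix is_box_block[of t s z] unfolding mixing_def by simp
    \<comment> \<open>Approximate factorisation of non-exceedance passes to exceedance with the same
      error, as the linear terms in \<open>exc_both_eq\<close> are exact.\<close>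
    then have "\<P>(\<omega> in M. \<not> exc_free X x ?A \<omega> \<and> \<not> exc_free X x ?B \<omega>)
        \<le> (1 - le_prob ?A) * (1 - le_prob ?B) + \<alpha>"
      by (simp add: exc_both_eq algebra_simps)
    also have "(1 - le_prob ?A) * (1 - le_prob ?B) = (1 - le_prob ?A)\<^sup>2"
      by (simp add: power2_eq_square block_prob[of t s z])
    also have "\<dots> \<le> (V * exc_prob)\<^sup>2"
    proof (rule power_mono)
      have "1 - le_prob ?A \<le> W * exc_prob"
        using exc_union_bound[of ?A] by (simp add: le_prob_exc cards)
      also have "\<dots> \<le> V * exc_prob" using WV by (simp add: mult_right_mono)
      finally show "1 - le_prob ?A \<le> V * exc_prob" .
    qed simp
    \<comment> \<open>Each of the two blocks has \<open>V - W\<close> sites outside its core, whence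
      the factor 2.\<close>
    finally show ?thesis
      using exc_both_mono[of ?A ?J ?B "block t t z"] sub
      by (simp add: cardt cards) (simp add: algebra_simps)
  qed
  have "1 - le_prob ?J \<le> V * last_prob (future R t)
      + \<P>(\<omega> in M. \<not> exc_free X x ?J \<omega> \<and> \<not> exc_free X x ?N \<omega>)"
    unfolding V_def
  proof (rule exc_upper[OF lin])
    fix v assume v: "v \<in> ?J"
    show "(+) v ` future R t \<subseteq> ?J \<union> ?N"
      unfolding future_translate[OF R] using nbr_cube_cover[OF t v] by blast
    show "(+) v ` future R t \<subseteq> {z. (v, z) \<in> R - Id}"
      unfolding future_translate[OF R] by blast
  qed auto
  also have "\<dots> \<le> V * last_prob (future R t) + real (card (nbr_cube - {0 :: int^'d})) * ?b"
    by (intro add_left_mono exc_both_UN_bound pair) auto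
  also have "\<dots> \<le> y"
  proof -
    \<comment> \<open>\<open>y\<close> counts the whole cube including the origin, which only
      enlarges the bound because \<open>?b\<close> is nonnegative.\<close>
    have "0 \<le> ?b" using mixing_nonneg[OF mix] WV by simp
    moreover have "card (nbr_cube - {0 :: int^'d}) \<le> card (nbr_cube :: (int^'d) set)"
      by (intro card_mono) auto
    ultimately show ?thesis unfolding y_def by (intro add_left_mono mult_right_mono) auto
  qed
  finally have J: "1 - y \<le> le_prob ?J" by linarith
  have "(1 - y) ^ card Z \<le> le_prob (block t s 0) ^ card Z"
  proof (rule power_mono)
    show "1 - y \<le> le_prob (block t s 0)"
      using J le_prob_antimono[OF sub, of 0] by simp
  qed (use y in simp)
  also have "\<dots> \<le> le_prob (\<Union>z\<in>Z. block t s z) + real (card Z) * \<alpha>"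
  proof -
    have "block t s z \<subseteq> K" if "z \<in> Z" for z using sub K that by blast
    from core_product[OF mix Z t g this] show ?thesis by linarith
  qed
  \<comment> \<open>Disjointness gives exactly \<open>V - W\<close> discarded sites per
    block.\<close>
  also have "le_prob (\<Union>z\<in>Z. block t s z) \<le> le_prob (\<Union>z\<in>Z. block t t z)
      + (real (card (\<Union>z\<in>Z. block t t z)) - card (\<Union>z\<in>Z. block t s z)) * exc_prob"
    by (rule le_prob_diff) (use sub Z in blast, use Z in simp)
  also have "card (\<Union>z\<in>Z. block t t z) = (\<Sum>z\<in>Z. card (block t t z))"
    using Z block_disjoint by (intro card_UN_disjoint) auto
  also have "card (\<Union>z\<in>Z. block t s z) = (\<Sum>z\<in>Z. card (block t s z))"
  proof (intro card_UN_disjoint ballI impI)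
    fix z w :: "int^'d" assume "z \<noteq> w"
    from block_disjoint[OF this, of t] show "block t s z \<inter> block t s w = {}"
      using sub by blast
  qed (use Z in auto)
  also have "le_prob (\<Union>z\<in>Z. block t t z) \<le> le_prob D"
    using Z D by (intro le_prob_antimono) auto
  finally show ?thesis by (simp add: cards cardt algebra_simps)
qed

end

section \<open>Asymptotics\<close>

text \<open>The bound is uniform in \<open>a\<close>, as needed for the first claim, where the
  exponent may be unbounded. The reason is that a * exp(-\<theta> a) \<le> 2 once \<theta> >
  1/2.\<close>

lemma exp_scaled_diff_le:
  fixes a \<theta> :: real
  assumes "0 \<le> a" "1/2 < \<theta>"
  shows "exp (- (\<theta> * a)) - exp (- a) \<le> 2 * \<bar>1 - \<theta>\<bar>"
proof -
  have "exp (- (\<theta> * a)) * (1 - (1 - \<theta>) * a) \<le> exp (- (\<theta> * a)) * exp (- ((1 - \<theta>) * a))"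
    using exp_ge_add_one_self[of "- ((1 - \<theta>) * a)"] by (intro mult_left_mono) auto
  also have "\<dots> = exp (- a)" by (simp add: exp_add[symmetric] algebra_simps)
  finally have "exp (- (\<theta> * a)) - exp (- a) \<le> (1 - \<theta>) * (a * exp (- (\<theta> * a)))"
    by (simp add: algebra_simps)
  also have "\<dots> \<le> \<bar>1 - \<theta>\<bar> * (a * exp (- (\<theta> * a)))"
    using assms by (intro mult_right_mono) auto
  also have "\<dots> \<le> \<bar>1 - \<theta>\<bar> * 2"
  proof (rule mult_left_mono)
    have "a \<le> 2 * (\<theta> * a)" using mult_right_mono[of "1/2" \<theta> a] assms by simp
    also have "\<dots> \<le> 2 * exp (\<theta> * a)" using exp_ge_add_one_self[of "\<theta> * a"] by linarith
    finally show "a * exp (- (\<theta> * a)) \<le> 2" by (simp add: exp_minus field_simps)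
  qed simp
  finally show ?thesis by simp
qed

text \<open>Only one side is required, so \<open>u\<close> may have any sign: exp(-a) \<le> 1 and 1
  - exp(-h) \<le> h suffice.\<close>

lemma exp_minus_diff_ge:
  fixes a u :: real
  assumes "0 \<le> a"
  shows "- \<bar>u - a\<bar> \<le> exp (- u) - exp (- a)"
proof -
  have "exp (- a) - exp (- u) = exp (- a) * (1 - exp (- (u - a)))"
    by (simp add: algebra_simps exp_add[symmetric])
  also have "\<dots> \<le> exp (- a) * \<bar>u - a\<bar>"
  proof (rule mult_left_mono)
    show "1 - exp (- (u - a)) \<le> \<bar>u - a\<bar>"
      using exp_ge_add_one_self[of "- (u - a)"] by linarith
  qed simp
  also have "\<dots> \<le> 1 * \<bar>u - a\<bar>" using assms by (intro mult_right_mono) auto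
  finally show ?thesis by simp
qed

text \<open>From ln(1-y) \<ge> -y - 2 y^2. The exponent is arranged so that its correction is the
  bounded quantity \<open>m * y\<close> times the null quantity \<open>y\<close>.\<close>

lemma one_minus_power_ge:
  fixes y :: real
  assumes "0 \<le> y" "y \<le> 1/2"
  shows "exp (- (real m * y + 2 * (real m * y) * y)) \<le> (1 - y) ^ m"
proof -
  have "- (real m * y + 2 * (real m * y) * y) = real m * (- y - 2 * y\<^sup>2)"
    by (simp add: algebra_simps power2_eq_square)
  also have "\<dots> \<le> real m * ln (1 - y)"
    using ln_one_minus_pos_lower_bound[OF assms] by (intro mult_left_mono) auto
  finally have "exp (- (real m * y + 2 * (real m * y) * y)) \<le> exp (real m * ln (1 - y))" by simp
  also have "\<dots> = (1 - y) ^ m" using assms by (simp add: exp_of_nat_mult)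
  finally show ?thesis .
qed

section \<open>Asymptotic sizes and numbers of blocks\<close>

locale block_asymptotics =
  fixes D :: "nat \<Rightarrow> (int^'d) set" and C :: "nat \<Rightarrow> (real^'d) set" and c \<gamma> :: "nat \<Rightarrow> real^'d"
    and k :: "nat \<Rightarrow> nat"
  assumes geo: "geometric_assumption D C c" and adm: "admissible c k"
    and gam: "vec_small_o (\<lambda>n. k_root TYPE('d) (k n) *\<^sub>R \<gamma> n) c"
begin

definition r where "r n = k_root TYPE('d) (k n)"
definition t where "t n = tint (c n) (k n)"
text \<open>Adding 1 to the floor makes the gap strictly larger than the modulus of \<gamma>. For
  small \<open>n\<close> a side may fail to be positive and the core is empty; \<open>s_pos\<close>
  excludes this eventually.\<close>

definition s where "s n = (\<chi> l. t n $ l - (\<lfloor>\<bar>\<gamma> n $ l\<bar>\<rfloor> + 1))"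
definition V where "V n = real (card (block (t n) (t n) 0))"
definition W where "W n = real (card (block (t n) (s n) 0))"

lemma c_pos [simp]: "0 < c n $ l"
  using geo by (auto simp: geometric_assumption_def)

lemma k_pos [simp]: "0 < k n"
  using adm by (auto simp: admissible_def)

lemma k_lim: "filterlim (\<lambda>n. real (k n)) at_top sequentially"
  using adm filterlim_compose[OF filterlim_real_sequentially] by (auto simp: admissible_def)

lemma r_ge_1: "1 \<le> r n"
  using k_pos[of n] unfolding r_def k_root_def
  by (subst real_root_ge_1_iff) (auto simp: Suc_le_eq)

lemma r_power: "r n ^ CARD('d) = real (k n)"
  unfolding r_def k_root_def by (simp add: real_root_pow_pos2)

lemma r_pos [simp]: "0 < r n"
  using r_ge_1[of n] by linarith

lemma r_lim: "filterlim r at_top sequentially"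
  unfolding filterlim_at_top
proof
  fix b :: real
  have "\<forall>\<^sub>F n in sequentially. max b 0 ^ CARD('d) \<le> real (k n)"
    using k_lim unfolding filterlim_at_top by blast
  then show "\<forall>\<^sub>F n in sequentially. b \<le> r n"
  proof eventually_elim
    case (elim n)
    then have "max b 0 ^ CARD('d) \<le> r n ^ CARD('d)" by (simp add: r_power)
    then have "max b 0 \<le> r n" by (subst (asm) power_mono_iff) (auto intro: less_imp_le)
    then show ?case by simp
  qed
qed

lemma r_c_lim: "(\<lambda>n. r n / c n $ l) \<longlonglongrightarrow> 0"
  using adm by (auto simp: admissible_def r_def)

lemma t_bounds: "c n $ l / r n - 1 < of_int (t n $ l)" "of_int (t n $ l) \<le> c n $ l / r n"
  unfolding t_def tint_def r_def[symmetric] vec_lambda_beta by linarith+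

text \<open>Rounding down costs less than 1, which relative to \<open>c / r\<close> is at most
  \<open>r / c\<close> and hence vanishes by admissibility.\<close>

lemma t_ratio_lim: "(\<lambda>n. r n * of_int (t n $ l) / c n $ l) \<longlonglongrightarrow> 1"
proof (rule tendsto_sandwich[where f = "\<lambda>n. 1 - r n / c n $ l" and h = "\<lambda>n. 1"])
  have *: "0 < r n / c n $ l" for n by simp
  show "\<forall>\<^sub>F n in sequentially. 1 - r n / c n $ l \<le> r n * of_int (t n $ l) / c n $ l"
  proof (rule always_eventually, rule allI)
    fix n
    have "(c n $ l / r n - 1) * (r n / c n $ l) \<le> of_int (t n $ l) * (r n / c n $ l)"
      using t_bounds(1)[of n l] * by (intro mult_right_mono) (auto intro: less_imp_le)
    moreover have "(c n $ l / r n - 1) * (r n / c n $ l) = 1 - r n / c n $ l"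
      using r_pos[of n] c_pos[of n l] by (simp add: field_simps del: r_pos c_pos)
    ultimately show "1 - r n / c n $ l \<le> r n * of_int (t n $ l) / c n $ l"
      by (simp add: mult.commute)
  qed
  show "\<forall>\<^sub>F n in sequentially. r n * of_int (t n $ l) / c n $ l \<le> 1"
  proof (rule always_eventually, rule allI)
    fix n
    have "of_int (t n $ l) * (r n / c n $ l) \<le> (c n $ l / r n) * (r n / c n $ l)"
      using t_bounds(2)[of n l] * by (intro mult_right_mono) (auto intro: less_imp_le)
    moreover have "(c n $ l / r n) * (r n / c n $ l) = 1"
      using r_pos[of n] c_pos[of n l] by (simp add: field_simps del: r_pos c_pos)
    ultimately show "r n * of_int (t n $ l) / c n $ l \<le> 1" by (simp add: mult.commute)
  qed
  show "(\<lambda>n. 1 - r n / c n $ l) \<longlonglongrightarrow> 1"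
    using tendsto_diff[OF tendsto_const[of 1] r_c_lim[of l]] by simp
qed simp

lemma t_ratio_ge: "\<forall>\<^sub>F n in sequentially. \<forall>l. 1/2 < r n * of_int (t n $ l) / c n $ l"
  by (rule eventually_all_finite) (rule order_tendstoD(1)[OF t_ratio_lim], simp)

lemma t_pos: "\<forall>\<^sub>F n in sequentially. \<forall>l. 0 < t n $ l"
  using t_ratio_ge
proof eventually_elim
  case (elim n)
  show ?case
  proof
    fix l
    have "0 < r n * of_int (t n $ l) / c n $ l" using elim[rule_format, of l] by linarith
    then have "0 < real_of_int (t n $ l)"
      using r_pos[of n] c_pos[of n l] by (simp add: zero_less_divide_iff zero_less_mult_iff del: r_pos c_pos)
    then show "0 < t n $ l" by simp
  qed
qed

lemma gap: "\<bar>\<gamma> n $ l\<bar> < of_int (t n $ l - s n $ l)"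
  by (simp add: s_def)

text \<open>With \<open>q\<close> the width of the gap, \<open>q / t\<close> is the quotient of
  \<open>r q / c\<close> and \<open>r t / c\<close>. The first tends to 0: its \<gamma>-part by the
  assumption on \<gamma>, the added 1 because \<open>r / c\<close> does.\<close>

lemma s_ratio_lim: "(\<lambda>n. of_int (s n $ l) / of_int (t n $ l)) \<longlonglongrightarrow> (1 :: real)"
proof -
  define q where "q n = of_int \<lfloor>\<bar>\<gamma> n $ l\<bar>\<rfloor> + (1 :: real)" for n
  have lim: "(\<lambda>n. \<bar>r n * \<gamma> n $ l / c n $ l\<bar> + r n / c n $ l) \<longlonglongrightarrow> 0"
    using gam r_c_lim[of l] by (intro tendsto_add_zero tendsto_rabs_zero) (auto simp: vec_small_o_def r_def)
  have bound: "norm (r n * q n / c n $ l) \<le> \<bar>r n * \<gamma> n $ l / c n $ l\<bar> + r n / c n $ l" for n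
  proof -
    have q: "0 \<le> q n" "q n \<le> \<bar>\<gamma> n $ l\<bar> + 1" by (auto simp: q_def)
    have "norm (r n * q n / c n $ l) = r n / c n $ l * q n"
      using q(1) r_pos[of n] c_pos[of n l] by (simp add: abs_mult del: r_pos c_pos)
    also have "\<dots> \<le> r n / c n $ l * (\<bar>\<gamma> n $ l\<bar> + 1)"
      using q(2) by (intro mult_left_mono) (auto intro: less_imp_le)
    also have "\<dots> = \<bar>r n * \<gamma> n $ l / c n $ l\<bar> + r n / c n $ l"
      using r_pos[of n] c_pos[of n l] by (simp add: abs_mult distrib_left del: r_pos c_pos)
    finally show ?thesis .
  qed
  have "(\<lambda>n. r n * q n / c n $ l) \<longlonglongrightarrow> 0"
    by (rule Lim_null_comparison[OF _ lim]) (use bound in simp)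
  from tendsto_divide[OF this t_ratio_lim[of l]]
  have "(\<lambda>n. 1 - (r n * q n / c n $ l) / (r n * of_int (t n $ l) / c n $ l)) \<longlonglongrightarrow> 1 - 0"
    by (intro tendsto_diff) auto
  moreover have "\<forall>\<^sub>F n in sequentially. 1 - (r n * q n / c n $ l) / (r n * of_int (t n $ l) / c n $ l)
      = of_int (s n $ l) / of_int (t n $ l)"
    using t_pos
  proof (rule eventually_mono)
    fix n assume "\<forall>l. 0 < t n $ l"
    then have "0 < real_of_int (t n $ l)" by simp
    then show "1 - (r n * q n / c n $ l) / (r n * of_int (t n $ l) / c n $ l)
      = of_int (s n $ l) / of_int (t n $ l)"
      using r_pos[of n] c_pos[of n l] by (simp add: s_def q_def field_simps del: r_pos c_pos)
  qed
  ultimately show ?thesis by (simp add: tendsto_cong)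
qed

lemma s_pos: "\<forall>\<^sub>F n in sequentially. \<forall>l. 0 < s n $ l"
proof (rule eventually_all_finite)
  fix l
  have "\<forall>\<^sub>F n in sequentially. (0::real) < of_int (s n $ l) / of_int (t n $ l)"
    by (rule order_tendstoD(1)[OF s_ratio_lim]) simp
  with t_pos show "\<forall>\<^sub>F n in sequentially. 0 < s n $ l"
  proof eventually_elim
    case (elim n)
    then have "0 < real_of_int (t n $ l)" by simp
    with elim(2) have "0 < real_of_int (s n $ l)" by (simp add: zero_less_divide_iff)
    then show ?case by simp
  qed
qed

lemma V_eq: "\<forall>\<^sub>F n in sequentially. V n = (\<Prod>l\<in>UNIV. of_int (t n $ l))"
  using t_pos by eventually_elim (simp add: V_def card_block less_imp_le)

lemma W_eq: "\<forall>\<^sub>F n in sequentially. W n = (\<Prod>l\<in>UNIV. of_int (s n $ l))"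
  using s_pos by eventually_elim (simp add: W_def card_block less_imp_le)

lemma V_pos: "\<forall>\<^sub>F n in sequentially. 0 < V n"
  using t_pos V_eq by eventually_elim (simp add: prod_pos)

lemma W_V_lim: "(\<lambda>n. W n / V n) \<longlonglongrightarrow> 1"
proof -
  have "(\<lambda>n. \<Prod>l\<in>UNIV. of_int (s n $ l) / of_int (t n $ l)) \<longlonglongrightarrow> (\<Prod>l\<in>(UNIV :: 'd set). 1 :: real)"
    by (intro tendsto_prod s_ratio_lim)
  moreover have "\<forall>\<^sub>F n in sequentially. (\<Prod>l\<in>UNIV. of_int (s n $ l) / of_int (t n $ l)) = W n / V n"
    using V_eq W_eq by eventually_elim (simp add: prod_dividef)
  ultimately show ?thesis by (simp add: tendsto_cong)
qed

text \<open>Since \<open>k = r^d\<close>, the ratio of \<open>k V\<close> to the product of the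
  scales is a product of d ratios tending to 1; that product is asymptotic to the volume by
  assumption.\<close>

lemma kV_volume_lim: "(\<lambda>n. real (k n) * V n / measure lebesgue (C n)) \<longlonglongrightarrow> 1"
proof -
  have cpos: "0 < (\<Prod>l\<in>UNIV. c n $ l)" for n by (simp add: prod_pos)
  have "(\<lambda>n. \<Prod>l\<in>UNIV. r n * of_int (t n $ l) / c n $ l) \<longlonglongrightarrow> (\<Prod>l\<in>(UNIV :: 'd set). 1 :: real)"
    by (intro tendsto_prod t_ratio_lim)
  moreover have "\<forall>\<^sub>F n in sequentially. (\<Prod>l\<in>UNIV. r n * of_int (t n $ l) / c n $ l)
      = real (k n) * V n / (\<Prod>l\<in>UNIV. c n $ l)"
    using V_eq by eventually_elim (simp add: prod_dividef prod.distrib r_power)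
  ultimately have 1: "(\<lambda>n. real (k n) * V n / (\<Prod>l\<in>UNIV. c n $ l)) \<longlonglongrightarrow> 1"
    by (simp add: tendsto_cong)
  have "(\<lambda>n. \<Prod>l\<in>UNIV. c n $ l) \<sim>[sequentially] (\<lambda>n. measure lebesgue (C n))"
    using geo by (simp add: geometric_assumption_def)
  \<comment> \<open>\<open>asymp_equiv_def\<close> makes an exception where both sides vanish, which
    positivity of the scales excludes.\<close>
  then have 2: "(\<lambda>n. (\<Prod>l\<in>UNIV. c n $ l) / measure lebesgue (C n)) \<longlonglongrightarrow> 1"
    using cpos by (simp add: asymp_equiv_def less_imp_neq[THEN not_sym])
  from tendsto_mult[OF 1 2] show ?thesis using cpos by (simp add: less_imp_neq[THEN not_sym])
qed

text \<open>\<open>C n\<close> has extent \<open>b * c\<close> and cells have sides at least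
  \<open>c / (2 r)\<close> eventually, so indices are at most \<open>2 b r\<close> up to rounding.
  The grid thus has order k^(1/d) cells along each axis.\<close>

lemma hit_cells_bounded:
  "\<exists>b>0. \<forall>\<^sub>F n in sequentially.
     hit_cells (C n) (t n) \<subseteq> {z. \<forall>l. \<bar>z $ l\<bar> \<le> int (nat \<lceil>b * r n\<rceil> + 1)}"
proof -
  obtain b where b: "b > 0" "\<And>n. C n \<subseteq> scale (c n) (sym_cube b)"
    using geo by (auto simp: geometric_assumption_def)
  have "\<forall>\<^sub>F n in sequentially. hit_cells (C n) (t n) \<subseteq> {z. \<forall>l. \<bar>z $ l\<bar> \<le> int (nat \<lceil>2 * b * r n\<rceil> + 1)}"
    using t_pos t_ratio_ge
  proof eventually_elim
    case (elim n)
    show ?case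
    proof (intro subsetI CollectI allI)
      fix z l assume "z \<in> hit_cells (C n) (t n)"
      then obtain y where y: "y \<in> cell (t n) z" "y \<in> C n" by (auto simp: hit_cells_def)
      have tp: "0 < real_of_int (t n $ l)" using elim(1) by simp
      have "1/2 < r n * of_int (t n $ l) / c n $ l" using elim(2) by blast
      then have "c n $ l \<le> 2 * r n * of_int (t n $ l)"
        using c_pos[of n l] by (simp add: field_simps del: c_pos)
      then have "b * c n $ l \<le> b * (2 * r n * of_int (t n $ l))" using b(1) by (intro mult_left_mono) auto
      moreover have "\<bar>y $ l\<bar> \<le> b * c n $ l" using y(2) b(2)[of n] by (auto simp: scale_sym_cube)
      moreover have "of_int (t n $ l) * of_int (z $ l) \<le> y $ l" "y $ l < of_int (t n $ l) * (of_int (z $ l) + 1)"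
        using y(1) by (auto simp: cell_def)
      ultimately have "of_int (t n $ l) * of_int (z $ l) \<le> of_int (t n $ l) * (2 * b * r n)"
        "of_int (t n $ l) * (- (2 * b * r n)) < of_int (t n $ l) * (of_int (z $ l) + 1)"
        unfolding abs_le_iff distrib_left mult_minus_right
        by (simp_all only: mult_ac mult_1_right, linarith+)
      then have "of_int (z $ l) \<le> 2 * b * r n" "- (2 * b * r n) < of_int (z $ l) + 1"
        using tp by (simp_all only: mult_le_cancel_left_pos mult_less_cancel_left_pos)
      then have "of_int \<bar>z $ l\<bar> \<le> 2 * b * r n + 1" by linarith
      moreover have "2 * b * r n \<le> real (nat \<lceil>2 * b * r n\<rceil>)" by (rule real_nat_ceiling_ge)
      ultimately have "of_int \<bar>z $ l\<bar> \<le> real (nat \<lceil>2 * b * r n\<rceil>) + 1" by linarith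
      then show "\<bar>z $ l\<bar> \<le> int (nat \<lceil>2 * b * r n\<rceil> + 1)" by linarith
    qed
  qed
  then show ?thesis using b(1) by (intro exI[of _ "2 * b"]) simp
qed

lemma finite_hit_cells: "\<forall>\<^sub>F n in sequentially. finite (hit_cells (C n) (t n))"
proof -
  have fin: "finite {z :: int^'d. \<forall>l. \<bar>z $ l\<bar> \<le> int N}" for N
    using finite_int_box[of "\<chi> l. - int N" "\<chi> l. int N :: int^'d"]
    by (simp add: abs_le_iff minus_le_iff conj_commute)
  obtain b where "\<forall>\<^sub>F n in sequentially.
     hit_cells (C n) (t n) \<subseteq> {z. \<forall>l. \<bar>z $ l\<bar> \<le> int (nat \<lceil>b * r n\<rceil> + 1)}"
    using hit_cells_bounded by blast
  then show ?thesis by eventually_elim (rule finite_subset[OF _ fin])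
qed

definition m where "m n = card (hit_cells (C n) (t n))"
definition i where "i n = card (inner_cells (C n) (t n))"

lemma i_le_m: "\<forall>\<^sub>F n in sequentially. i n \<le> m n"
  using t_pos finite_hit_cells unfolding i_def m_def
  by eventually_elim (auto intro!: card_mono inner_cells_subset_hits)

text \<open>The boundary count has order r^(d-1), while k = r^d, leaving a factor 1/r.\<close>

lemma boundary_lim: "(\<lambda>n. (real (m n) - real (i n)) / real (k n)) \<longlonglongrightarrow> 0"
proof -
  let ?d = "CARD('d)"
  obtain p where p: "\<And>n. p_convex p (C n)" using geo by (auto simp: geometric_assumption_def)
  obtain b where b: "b > 0" and hits: "\<forall>\<^sub>F n in sequentially.
     hit_cells (C n) (t n) \<subseteq> {z. \<forall>l. \<bar>z $ l\<bar> \<le> int (nat \<lceil>b * r n\<rceil> + 1)}"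
    using hit_cells_bounded by blast
  \<comment> \<open>The base \<open>2 b + 5\<close> absorbs
    \<open>2 * ?N + 1 \<le> 2 b r + 5\<close>, using \<open>r \<ge> 1\<close>.\<close>
  define B where "B = real p * (2 * (real ?d)\<^sup>2 * (2 * b + 5) ^ (?d - 1))"
  have "\<forall>\<^sub>F n in sequentially. norm ((real (m n) - real (i n)) / real (k n)) \<le> B * inverse (r n)"
    using t_pos hits finite_hit_cells i_le_m
  proof eventually_elim
    case (elim n)
    let ?N = "nat \<lceil>b * r n\<rceil> + 1"
    have "inner_cells (C n) (t n) \<subseteq> hit_cells (C n) (t n)"
      using elim(1) by (intro inner_cells_subset_hits) auto
    then have "real (m n) - real (i n) = real (card (hit_cells (C n) (t n) - inner_cells (C n) (t n)))"
      using elim(3,4) by (simp add: m_def i_def card_Diff_subset finite_subset of_nat_diff)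
    also have "\<dots> \<le> real (p * (2 * ?d\<^sup>2 * (2 * ?N + 1) ^ (?d - 1)))"
      unfolding of_nat_le_iff using elim(1,2) by (intro card_boundary_p_convex p) auto
    also have "\<dots> = real p * (2 * (real ?d)\<^sup>2 * real (2 * ?N + 1) ^ (?d - 1))" by simp
    also have "\<dots> \<le> real p * (2 * (real ?d)\<^sup>2 * ((2 * b + 5) * r n) ^ (?d - 1))"
    proof (intro mult_left_mono power_mono)
      have "real (nat \<lceil>b * r n\<rceil>) \<le> b * r n + 1"
        using b by (simp add: less_imp_le)
      then have "real (2 * ?N + 1) \<le> 2 * (b * r n) + 5" by simp
      also have "\<dots> \<le> (2 * b + 5) * r n" using r_ge_1[of n] by (simp add: algebra_simps)
      finally show "real (2 * ?N + 1) \<le> (2 * b + 5) * r n" .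
    qed auto
    also have "\<dots> = B * r n ^ (?d - 1)" by (simp add: B_def power_mult_distrib)
    finally have "(real (m n) - real (i n)) / real (k n) \<le> B * r n ^ (?d - 1) / real (k n)"
      by (intro divide_right_mono) auto
    also have "\<dots> = B * inverse (r n)"
    proof -
      have "real (k n) = r n ^ (?d - 1) * r n"
        using power_minus_mult[of "CARD('d)" "r n"] by (simp add: r_power)
      then show ?thesis using r_pos[of n] by (simp add: field_simps del: r_pos)
    qed
    finally show ?case using elim(4) by simp
  qed
  moreover have "(\<lambda>n. B * inverse (r n)) \<longlonglongrightarrow> 0"
    by (intro tendsto_mult_right_zero tendsto_inverse_0_at_top r_lim)
  ultimately show ?thesis by (rule Lim_null_comparison)
qed

lemma cell_volume_bounds: "\<forall>\<^sub>F n in sequentially.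
    real (i n) / real (k n) \<le> measure lebesgue (C n) / (real (k n) * V n)
  \<and> measure lebesgue (C n) / (real (k n) * V n) \<le> real (m n) / real (k n)"
  using t_pos finite_hit_cells V_eq V_pos
proof eventually_elim
  case (elim n)
  obtain p where p: "p_convex p (C n)" using geo by (auto simp: geometric_assumption_def)
  have "real (i n) * V n \<le> measure lebesgue (C n)" "measure lebesgue (C n) \<le> real (m n) * V n"
    unfolding i_def m_def elim(3) using volume_bounds[of "t n" "C n"] elim p p_convex_lmeasurable by auto
  then show ?case using elim(4) by (auto simp: field_simps)
qed

text \<open>The normalised volume tends to 1 and lies between \<open>i / k\<close> and
  \<open>m / k\<close>, whose difference vanishes.\<close>

lemma m_lim: "(\<lambda>n. real (m n) / real (k n)) \<longlonglongrightarrow> 1"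
  and i_lim: "(\<lambda>n. real (i n) / real (k n)) \<longlonglongrightarrow> 1"
proof -
  let ?v = "\<lambda>n. measure lebesgue (C n) / (real (k n) * V n)"
  let ?b = "\<lambda>n. (real (m n) - real (i n)) / real (k n)"
  have v: "?v \<longlonglongrightarrow> 1"
    using tendsto_inverse[OF kV_volume_lim] by (simp add: inverse_eq_divide)
  have l: "(\<lambda>n. ?v n - ?b n) \<longlonglongrightarrow> 1" "(\<lambda>n. ?v n + ?b n) \<longlonglongrightarrow> 1"
    using tendsto_diff[OF v boundary_lim] tendsto_add[OF v boundary_lim] by simp_all
  show "(\<lambda>n. real (m n) / real (k n)) \<longlonglongrightarrow> 1"
    by (rule tendsto_sandwich[OF _ _ v l(2)])
       (use cell_volume_bounds in \<open>eventually_elim, simp add: diff_divide_distrib\<close>)+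
  show "(\<lambda>n. real (i n) / real (k n)) \<longlonglongrightarrow> 1"
    by (rule tendsto_sandwich[OF _ _ l(1) v])
       (use cell_volume_bounds in \<open>eventually_elim, simp add: diff_divide_distrib\<close>)+
qed

lemma D_eq: "D n = lattice_points (C n)"
  using geo by (simp add: geometric_assumption_def)

lemma finite_D: "\<forall>\<^sub>F n in sequentially. finite (D n)"
  using t_pos finite_hit_cells by eventually_elim (metis D_eq lattice_bounds(1))

lemma card_D_lim: "(\<lambda>n. real (card (D n)) / (real (k n) * V n)) \<longlonglongrightarrow> 1"
proof (rule tendsto_sandwich[OF _ _ i_lim m_lim])
  have *: "\<forall>\<^sub>F n in sequentially. real (i n) * V n \<le> real (card (D n))
      \<and> real (card (D n)) \<le> real (m n) * V n \<and> 0 < V n"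
    using t_pos finite_hit_cells V_eq V_pos
  proof eventually_elim
    case (elim n)
    show ?case
      unfolding i_def m_def elim(3) D_eq using lattice_bounds[of "t n" "C n"] elim by auto
  qed
  show "\<forall>\<^sub>F n in sequentially. real (i n) / real (k n) \<le> real (card (D n)) / (real (k n) * V n)"
    using * by eventually_elim (simp add: field_simps)
  show "\<forall>\<^sub>F n in sequentially. real (card (D n)) / (real (k n) * V n) \<le> real (m n) / real (k n)"
    using * by eventually_elim (simp add: field_simps)
qed

text \<open>Neighbour pairs are always compared at the origin, so condition D needs these blocks
  inside \<open>K_set\<close>. Their coordinates are at most \<open>2 t \<le> 2 c / r\<close>, and
  \<open>r\<close> tends to infinity.\<close>

lemma nbr_blocks_subset:
  assumes "0 < \<kappa>"
  shows "\<forall>\<^sub>F n in sequentially. (\<Union>z\<in>nbr_cube. block (t n) (t n) z) \<subseteq> K_set \<kappa> (c n)"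
proof -
  have "\<forall>\<^sub>F n in sequentially. 2 / \<kappa> \<le> r n"
    using r_lim by (simp add: filterlim_at_top)
  with t_pos show ?thesis
  proof eventually_elim
    case (elim n)
    show ?case
    proof (intro UN_least subsetI)
      fix z v assume z: "z \<in> nbr_cube" and v: "v \<in> block (t n) (t n) z"
      have "\<bar>of_int (v $ l)\<bar> \<le> \<kappa> * c n $ l" for l
      proof -
        have "- 1 \<le> z $ l" "z $ l \<le> 1" using z by (simp_all add: nbr_cube_def)
        then have "t n $ l * (- 1) \<le> t n $ l * z $ l" "t n $ l * z $ l \<le> t n $ l * 1"
          using elim(1) by (intro mult_left_mono; simp add: less_imp_le)+
        moreover have "t n $ l * z $ l \<le> v $ l" "v $ l < t n $ l * z $ l + t n $ l"
          using v by (simp_all add: block_def)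
        moreover have "0 < t n $ l" using elim(1) by blast
        ultimately have "\<bar>v $ l\<bar> \<le> 2 * t n $ l" unfolding abs_le_iff by linarith
        then have "\<bar>of_int (v $ l)\<bar> \<le> 2 * real_of_int (t n $ l)" by linarith
        also have "\<dots> \<le> 2 * (c n $ l / r n)" using t_bounds(2)[of n l] by simp
        also have "\<dots> \<le> \<kappa> * c n $ l"
        proof -
          have "2 / r n \<le> \<kappa>" using elim(2) assms r_pos[of n] by (simp add: field_simps del: r_pos)
          then have "2 / r n * c n $ l \<le> \<kappa> * c n $ l" by (intro mult_right_mono) (auto intro: less_imp_le)
          then show ?thesis by simp
        qed
        finally show ?thesis .
      qed
      then show "v \<in> K_set \<kappa> (c n)" by (simp add: K_set_eq)
    qed
  qed
qed

end

section \<open>Vanishing of the remainder terms\<close>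

text \<open>With \<open>N * E\<close> bounded, \<open>E\<close> has order at most 1/(k V). Each
  product below is written as ratios with known limits times bounded factors \<open>N * E\<close> or
  \<open>N * Q\<close>.\<close>

lemma remainder_lim:
  fixes k V W N m Q E \<alpha> :: "nat \<Rightarrow> real" and b c :: real
  assumes pos: "\<forall>\<^sub>F n in sequentially. 0 < k n \<and> 0 < V n \<and> 0 < N n \<and> 0 < m n"
    and k: "filterlim k at_top sequentially"
    and WV: "(\<lambda>n. W n / V n) \<longlonglongrightarrow> 1" and Nk: "(\<lambda>n. N n / (k n * V n)) \<longlonglongrightarrow> 1"
    and mk: "(\<lambda>n. m n / k n) \<longlonglongrightarrow> 1" and k\<alpha>: "(\<lambda>n. k n * \<alpha> n) \<longlonglongrightarrow> 0"
    and Q: "\<And>n. 0 \<le> Q n" "\<And>n. Q n \<le> E n"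
    and NE: "\<forall>\<^sub>F n in sequentially. N n * E n \<le> b"
  defines "y \<equiv> \<lambda>n. V n * Q n + c * ((V n * E n)\<^sup>2 + \<alpha> n + 2 * ((V n - W n) * E n))"
  shows "y \<longlonglongrightarrow> 0" "(\<lambda>n. m n * y n + 2 * (m n * y n) * y n - N n * Q n) \<longlonglongrightarrow> 0"
    "(\<lambda>n. m n * \<alpha> n + m n * ((V n - W n) * E n)) \<longlonglongrightarrow> 0"
proof -
  have b: "\<forall>\<^sub>F n in sequentially. norm (N n * E n) \<le> b \<and> norm (N n * Q n) \<le> b"
    using pos NE
  proof eventually_elim
    case (elim n)
    then have "0 \<le> N n * Q n" "N n * Q n \<le> N n * E n" using Q[of n] by (auto intro: mult_left_mono)
    with elim(2) show ?case by simp
  qed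
  have bE: "\<forall>\<^sub>F n in sequentially. norm (N n * E n) \<le> b"
    and bQ: "\<forall>\<^sub>F n in sequentially. norm (N n * Q n) \<le> b"
    using b by (auto elim: eventually_mono)
  note null = lim_null_mult_right_bounded
  have ik: "(\<lambda>n. 1 / k n) \<longlonglongrightarrow> 0"
    using tendsto_inverse_0_at_top[OF k] by (simp add: inverse_eq_divide)
  have \<rho>: "(\<lambda>n. k n * V n / N n) \<longlonglongrightarrow> 1"
    using tendsto_inverse[OF Nk] by (simp add: inverse_eq_divide)
  have im: "(\<lambda>n. 1 / m n) \<longlonglongrightarrow> 0"
  proof (rule Lim_transform_eventually)
    show "(\<lambda>n. (1 / k n) / (m n / k n)) \<longlonglongrightarrow> 0"
      using tendsto_divide[OF ik mk] by simp
    show "\<forall>\<^sub>F n in sequentially. (1 / k n) / (m n / k n) = 1 / m n"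
      using pos by eventually_elim simp
  qed
  have 1: "(\<lambda>n. m n * V n * Q n - N n * Q n) \<longlonglongrightarrow> 0"
  proof (rule Lim_transform_eventually)
    have "(\<lambda>n. (m n / k n) * (k n * V n / N n) - 1) \<longlonglongrightarrow> 1 * 1 - 1"
      by (intro tendsto_intros mk \<rho>)
    then show "(\<lambda>n. ((m n / k n) * (k n * V n / N n) - 1) * (N n * Q n)) \<longlonglongrightarrow> 0"
      by (intro null[OF _ bQ]) simp
    show "\<forall>\<^sub>F n in sequentially. ((m n / k n) * (k n * V n / N n) - 1) * (N n * Q n) = m n * V n * Q n - N n * Q n"
      using pos by eventually_elim (simp add: field_simps)
  qed
  have 2: "(\<lambda>n. m n * (V n * E n)\<^sup>2) \<longlonglongrightarrow> 0"
  proof (rule Lim_transform_eventually)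
    \<comment> \<open>The square of \<open>V * E\<close> has order 1/k^2, so multiplying by
      \<open>m\<close> still leaves 1/k.\<close>
    have "(\<lambda>n. (m n / k n) * (1 / k n) * (k n * V n / N n)\<^sup>2) \<longlonglongrightarrow> 1 * 0 * 1\<^sup>2"
      by (intro tendsto_intros mk ik \<rho>)
    then show "(\<lambda>n. (m n / k n) * (1 / k n) * (k n * V n / N n)\<^sup>2 * (N n * E n) * (N n * E n)) \<longlonglongrightarrow> 0"
      by (intro null[OF null[OF _ bE] bE]) simp
    show "\<forall>\<^sub>F n in sequentially. (m n / k n) * (1 / k n) * (k n * V n / N n)\<^sup>2 * (N n * E n) * (N n * E n)
        = m n * (V n * E n)\<^sup>2"
      using pos by eventually_elim (simp add: field_simps power2_eq_square)
  qed
  have 3: "(\<lambda>n. m n * \<alpha> n) \<longlonglongrightarrow> 0"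
  proof (rule Lim_transform_eventually)
    show "(\<lambda>n. (m n / k n) * (k n * \<alpha> n)) \<longlonglongrightarrow> 0"
      using tendsto_mult[OF mk k\<alpha>] by simp
    show "\<forall>\<^sub>F n in sequentially. (m n / k n) * (k n * \<alpha> n) = m n * \<alpha> n"
      using pos by eventually_elim simp
  qed
  have 4: "(\<lambda>n. m n * ((V n - W n) * E n)) \<longlonglongrightarrow> 0"
  proof (rule Lim_transform_eventually)
    have "(\<lambda>n. (m n / k n) * (1 - W n / V n) * (k n * V n / N n)) \<longlonglongrightarrow> 1 * (1 - 1) * 1"
      by (intro tendsto_intros mk WV \<rho>)
    then show "(\<lambda>n. (m n / k n) * (1 - W n / V n) * (k n * V n / N n) * (N n * E n)) \<longlonglongrightarrow> 0"
      by (intro null[OF _ bE]) simp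
    show "\<forall>\<^sub>F n in sequentially. (m n / k n) * (1 - W n / V n) * (k n * V n / N n) * (N n * E n)
        = m n * ((V n - W n) * E n)"
      using pos by eventually_elim (simp add: field_simps)
  qed
  show "(\<lambda>n. m n * \<alpha> n + m n * ((V n - W n) * E n)) \<longlonglongrightarrow> 0"
    by (intro tendsto_add_zero 3 4)
  have "(\<lambda>n. (m n * V n * Q n - N n * Q n)
      + c * (m n * (V n * E n)\<^sup>2 + m n * \<alpha> n + 2 * (m n * ((V n - W n) * E n)))) \<longlonglongrightarrow> 0 + c * (0 + 0 + 2 * 0)"
    by (intro tendsto_intros 1 2 3 4)
  moreover have "(m n * V n * Q n - N n * Q n)
      + c * (m n * (V n * E n)\<^sup>2 + m n * \<alpha> n + 2 * (m n * ((V n - W n) * E n))) = m n * y n - N n * Q n" for n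
    by (simp add: y_def algebra_simps)
  ultimately have my: "(\<lambda>n. m n * y n - N n * Q n) \<longlonglongrightarrow> 0" by simp
  show y: "y \<longlonglongrightarrow> 0"
  proof (rule Lim_transform_eventually)
    \<comment> \<open>\<open>y\<close> is recovered from \<open>m * y\<close>, which is bounded, on
      division by \<open>m\<close>.\<close>
    show "(\<lambda>n. (m n * y n - N n * Q n) * (1 / m n) + 1 / m n * (N n * Q n)) \<longlonglongrightarrow> 0"
      using tendsto_mult[OF my im] by (intro tendsto_add_zero null[OF im bQ]) simp
    show "\<forall>\<^sub>F n in sequentially. (m n * y n - N n * Q n) * (1 / m n) + 1 / m n * (N n * Q n) = y n"
      using pos by eventually_elim (simp add: field_simps)
  qed
  have "(\<lambda>n. (m n * y n - N n * Q n) + 2 * ((m n * y n - N n * Q n) * y n + y n * (N n * Q n)))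
      \<longlonglongrightarrow> 0 + 2 * (0 * 0 + 0)"
    by (intro tendsto_intros my y null[OF y bQ])
  then show "(\<lambda>n. m n * y n + 2 * (m n * y n) * y n - N n * Q n) \<longlonglongrightarrow> 0"
    by (simp add: algebra_simps)
qed

section \<open>From the block bounds to the limit statement\<close>

lemma finite_K_set:
  assumes "\<And>l. 0 < c $ l"
  shows "finite (K_set \<kappa> c)"
proof (rule finite_subset[OF _ finite_int_box[of "\<chi> l. - \<lceil>\<kappa> * c $ l\<rceil>" "\<chi> l. \<lceil>\<kappa> * c $ l\<rceil>"]])
  have "- \<lceil>\<kappa> * c $ l\<rceil> \<le> v $ l \<and> v $ l \<le> \<lceil>\<kappa> * c $ l\<rceil>"
    if "\<bar>of_int (v $ l)\<bar> \<le> \<kappa> * c $ l" for v :: "int^'a" and l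
    using that by linarith
  then show "K_set \<kappa> c \<subseteq> {z. \<forall>l. (\<chi> l. - \<lceil>\<kappa> * c $ l\<rceil>) $ l \<le> z $ l \<and> z $ l \<le> (\<chi> l. \<lceil>\<kappa> * c $ l\<rceil>) $ l}"
    by (auto simp: K_set_eq[OF assms])
qed

theorem lemma3p2:
  fixes M :: "'w measure"
    and \<xi> :: "int^'d \<Rightarrow> 'w \<Rightarrow> real"
    and D :: "nat \<Rightarrow> (int^'d) set"
    and C :: "nat \<Rightarrow> (real^'d) set"
    and c \<gamma> :: "nat \<Rightarrow> real^'d"
    and \<alpha> x :: "nat \<Rightarrow> real"
    and \<kappa> :: real
    and k :: "nat \<Rightarrow> nat"
    and R :: "(int^'d) rel"
  assumes "prob_space M"
    and "translation_invariant_total_order R"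
    and "geometric_assumption D C c"
    and "stationary_field M \<xi>"
    and "0 < \<kappa>"
    and "condition_D M \<xi> c x (\<lambda>n. K_set \<kappa> (c n)) \<gamma> \<alpha>"
    and "admissible c k"
    and "\<forall>n. D_plus (C n) (c n) (k n) \<subseteq> K_set \<kappa> (c n)"
    and "(\<lambda>n. real (k n) * \<alpha> n) \<longlonglongrightarrow> 0"
    and "vec_small_o (\<lambda>n. k_root TYPE('d) (k n) *\<^sub>R \<gamma> n) c"
  shows "(\<exists>e. e \<longlonglongrightarrow> 0 \<and>
            (\<forall>n. \<P>(\<omega> in M. field_max \<xi> (D n) \<omega> \<le> ereal (x n))
              \<le> exp (- real (card (D n)) *
                    \<P>(\<omega> in M. field_max \<xi> (A_set R (c n) (k n) 0) \<omega> \<le> ereal (x n)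
                              \<and> x n < \<xi> 0 \<omega>)) + e n))
    \<and> (limsup (\<lambda>n. ereal (real (card (D n)) * \<P>(\<omega> in M. x n < \<xi> 0 \<omega>))) < \<infinity> \<longrightarrow>
        (\<exists>e. e \<longlonglongrightarrow> 0 \<and>
            (\<forall>n. \<P>(\<omega> in M. field_max \<xi> (D n) \<omega> \<le> ereal (x n))
              = exp (- real (card (D n)) *
                    \<P>(\<omega> in M. field_max \<xi> (A_set R (c n) (k n) 0) \<omega> \<le> ereal (x n)
                              \<and> x n < \<xi> 0 \<omega>)) + e n)))"
proof -
  interpret B: block_asymptotics D C c \<gamma> k
    using assms by unfold_locales auto
  have L: "level_field M \<xi>"
    using assms by (simp add: level_field_def level_field_axioms_def)
  define P where "P n = \<P>(\<omega> in M. field_max \<xi> (D n) \<omega> \<le> ereal (x n))" for n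
  define Q where "Q n = \<P>(\<omega> in M. field_max \<xi> (A_set R (c n) (k n) 0) \<omega> \<le> ereal (x n) \<and> x n < \<xi> 0 \<omega>)" for n
  define E where "E n = \<P>(\<omega> in M. x n < \<xi> 0 \<omega>)" for n
  define N where "N n = real (card (D n))" for n
  define d where "d n = P n - exp (- (N n * Q n))" for n
  have Q_nonneg: "0 \<le> Q n" for n by (simp add: Q_def)
  have E_eq: "E n = level_field.exc_prob M \<xi> (x n)" for n
    by (simp add: E_def level_field.exc_prob_def[OF L])
  have Q_le: "Q n \<le> E n" for n
  proof -
    interpret level_field M \<xi> "x n" by (rule L)
    show ?thesis unfolding Q_def E_def by (rule finite_measure_mono) auto
  qed
  have P_eq: "\<forall>\<^sub>F n in sequentially. P n = level_field.le_prob M \<xi> (x n) (D n)"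
    using B.finite_D by eventually_elim (simp add: P_def level_field.le_prob_def[OF L] field_max_le_iff)
  have Q_eq: "\<forall>\<^sub>F n in sequentially. Q n = level_field.last_prob M \<xi> (x n) (future R (B.t n))"
    using B.t_pos
  proof eventually_elim
    case (elim n)
    then have "A_set R (c n) (k n) 0 = future R (B.t n)"
      unfolding B.t_def by (intro A_set_eq) auto
    then show ?case by (simp add: Q_def level_field.last_prob_def[OF L] field_max_le_iff)
  qed
  \<comment> \<open>Subsets of \<open>K_set\<close> are finite, so \<open>field_max\<close> is a
    genuine maximum and condition D becomes a statement on \<open>le_prob\<close>.\<close>
  have mix: "level_field.mixing M \<xi> (x n) (K_set \<kappa> (c n)) (\<gamma> n) (\<alpha> n)" for n
    unfolding level_field.mixing_def[OF L]
  proof (intro allI impI)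
    fix A B :: "(int^'d) set"
    assume AB: "A \<subseteq> K_set \<kappa> (c n) \<and> B \<subseteq> K_set \<kappa> (c n) \<and> separated (\<gamma> n) A B \<and> (is_box A \<or> is_box B)"
    have "finite (K_set \<kappa> (c n))" by (rule finite_K_set) simp
    then have fin: "finite A" "finite B" using AB finite_subset by auto
    have "\<bar>\<P>(\<omega> in M. field_max \<xi> (A \<union> B) \<omega> \<le> ereal (x n))
          - \<P>(\<omega> in M. field_max \<xi> A \<omega> \<le> ereal (x n))
            * \<P>(\<omega> in M. field_max \<xi> B \<omega> \<le> ereal (x n))\<bar> \<le> \<alpha> n"
      using assms(6) AB unfolding condition_D_def by blast
    then show "\<bar>level_field.le_prob M \<xi> (x n) (A \<union> B)
        - level_field.le_prob M \<xi> (x n) A * level_field.le_prob M \<xi> (x n) B\<bar> \<le> \<alpha> n"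
      using fin by (simp add: level_field.le_prob_def[OF L] field_max_le_iff)
  qed
  have K: "\<forall>\<^sub>F n in sequentially. (\<Union>z\<in>hit_cells (C n) (B.t n). block (B.t n) (B.t n) z) \<subseteq> K_set \<kappa> (c n)"
    using B.t_pos
  proof eventually_elim
    case (elim n)
    have "D_plus (C n) (c n) (k n) = (\<Union>z\<in>hit_cells (C n) (B.t n). block (B.t n) (B.t n) z)"
      unfolding B.t_def by (rule D_plus_eq) (use elim in \<open>simp add: B.t_def\<close>)
    then show ?case using assms(8) by metis
  qed
  have pos: "\<forall>\<^sub>F n in sequentially. 0 < real (k n) \<and> 0 < B.V n \<and> 0 < N n \<and> 0 < real (B.m n)"
  proof -
    have "\<forall>\<^sub>F n in sequentially. 0 < N n / (real (k n) * B.V n)"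
      unfolding N_def by (rule order_tendstoD(1)[OF B.card_D_lim]) simp
    moreover have "\<forall>\<^sub>F n in sequentially. 0 < real (B.m n) / real (k n)"
      by (rule order_tendstoD(1)[OF B.m_lim]) simp
    ultimately show ?thesis using B.V_pos
      by eventually_elim (auto simp: zero_less_divide_iff zero_less_mult_iff N_def)
  qed

  \<comment> \<open>The ratio of the exponent produced by the inner cores to the desired
    one.\<close>
  define \<theta> where "\<theta> n = real (B.i n) * B.W n / N n" for n
  have \<theta>_lim: "\<theta> \<longlonglongrightarrow> 1"
  proof (rule Lim_transform_eventually)
    have "(\<lambda>n. real (B.i n) / real (k n) * (B.W n / B.V n) / (N n / (real (k n) * B.V n))) \<longlonglongrightarrow> 1 * 1 / 1"
      unfolding N_def by (intro tendsto_intros B.i_lim B.W_V_lim B.card_D_lim) simp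
    then show "(\<lambda>n. real (B.i n) / real (k n) * (B.W n / B.V n) / (N n / (real (k n) * B.V n))) \<longlonglongrightarrow> 1"
      by simp
    show "\<forall>\<^sub>F n in sequentially. real (B.i n) / real (k n) * (B.W n / B.V n) / (N n / (real (k n) * B.V n)) = \<theta> n"
      using pos by eventually_elim (simp add: \<theta>_def)
  qed
  define u where "u n = 2 * \<bar>1 - \<theta> n\<bar> + real (B.i n) / real (k n) * (real (k n) * \<alpha> n)" for n
  have u_lim: "u \<longlonglongrightarrow> 0"
  proof -
    have "u \<longlonglongrightarrow> 2 * \<bar>1 - 1\<bar> + 1 * 0"
      unfolding u_def by (intro tendsto_intros \<theta>_lim B.i_lim assms(9))
    then show ?thesis by simp
  qed
  have upper: "\<forall>\<^sub>F n in sequentially. d n \<le> u n"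
  proof -
    have "\<forall>\<^sub>F n in sequentially. 1/2 < \<theta> n" by (rule order_tendstoD(1)[OF \<theta>_lim]) simp
    with P_eq Q_eq K B.t_pos B.finite_D B.finite_hit_cells pos show ?thesis
    proof eventually_elim
      case (elim n)
      interpret level_field M \<xi> "x n" by (rule L)
      let ?Z = "inner_cells (C n) (B.t n)"
      have sub: "?Z \<subseteq> hit_cells (C n) (B.t n)"
        using elim(4) by (intro inner_cells_subset_hits) auto
      have "le_prob (D n) \<le> exp (- (real (card ?Z) * real (card (block (B.t n) (B.s n) 0))
          * last_prob (future R (B.t n)))) + real (card ?Z) * \<alpha> n"
      proof (rule max_prob_upper[OF assms(2) mix])
        show "finite ?Z" using sub elim(6) by (rule finite_subset)
        show "(\<Union>z\<in>?Z. block (B.t n) (B.t n) z) \<subseteq> K_set \<kappa> (c n)" using sub elim(3) by blast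
        show "(\<Union>z\<in>?Z. block (B.t n) (B.t n) z) \<subseteq> D n"
          unfolding B.D_eq by (rule blocks_inner_subset)
      qed (use elim B.gap in auto)
      then have "P n \<le> exp (- (real (B.i n) * B.W n * Q n)) + real (B.i n) * \<alpha> n"
        unfolding elim(1,2) B.i_def B.W_def .
      also have "real (B.i n) * B.W n * Q n = \<theta> n * (N n * Q n)"
        using elim(7) by (simp add: \<theta>_def)
      also have "exp (- (\<theta> n * (N n * Q n))) \<le> exp (- (N n * Q n)) + 2 * \<bar>1 - \<theta> n\<bar>"
        using exp_scaled_diff_le[of "N n * Q n" "\<theta> n"] elim(7,8) Q_nonneg[of n] by simp
      also have "real (B.i n) * \<alpha> n = real (B.i n) / real (k n) * (real (k n) * \<alpha> n)"
        using elim(7) by (metis nonzero_eq_divide_eq less_irrefl mult.assoc times_divide_eq_left)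
      finally show ?case unfolding d_def u_def by linarith
    qed
  qed

  have part1: "\<exists>e. e \<longlonglongrightarrow> 0 \<and> (\<forall>n. P n \<le> exp (- N n * Q n) + e n)"
  proof (intro exI conjI allI)
    \<comment> \<open>Taking the positive part of the exact difference makes the inequality hold for
      every \<open>n\<close>, also where the block bounds are not yet available.\<close>
    show "(\<lambda>n. max 0 (d n)) \<longlonglongrightarrow> 0"
    proof (rule Lim_null_comparison)
      show "\<forall>\<^sub>F n in sequentially. norm (max 0 (d n)) \<le> \<bar>u n\<bar>"
        using upper by eventually_elim auto
      show "(\<lambda>n. \<bar>u n\<bar>) \<longlonglongrightarrow> 0" using u_lim by (rule tendsto_rabs_zero)
    qed
    show "P n \<le> exp (- N n * Q n) + max 0 (d n)" for n by (simp add: d_def)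
  qed

  have part2: "\<exists>e. e \<longlonglongrightarrow> 0 \<and> (\<forall>n. P n = exp (- N n * Q n) + e n)"
    if limsup: "limsup (\<lambda>n. ereal (N n * E n)) < \<infinity>"
  proof -
    obtain b where "limsup (\<lambda>n. ereal (N n * E n)) < ereal (real b)"
      using limsup less_PInf_Ex_of_nat by (metis less_irrefl)
    then have NE: "\<forall>\<^sub>F n in sequentially. N n * E n \<le> real b"
      by (auto dest!: Limsup_lessD elim!: eventually_mono)
    define n3 where "n3 = real (card (nbr_cube :: (int^'d) set))"
    define y where "y n = B.V n * Q n + n3 * ((B.V n * E n)\<^sup>2 + \<alpha> n + 2 * ((B.V n - B.W n) * E n))" for n
    \<comment> \<open>\<open>v\<close> is the excess of the exponent supplied by the hit blocks over
      the desired one, \<open>w\<close> the additive loss.\<close>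
    define v where "v n = real (B.m n) * y n + 2 * (real (B.m n) * y n) * y n - N n * Q n" for n
    define w where "w n = real (B.m n) * \<alpha> n + real (B.m n) * ((B.V n - B.W n) * E n)" for n
    note rl = remainder_lim[OF pos B.k_lim B.W_V_lim B.card_D_lim[folded N_def] B.m_lim assms(9) Q_nonneg Q_le NE]
    have y_lim: "y \<longlonglongrightarrow> 0" unfolding y_def by (rule rl(1))
    have v_lim: "v \<longlonglongrightarrow> 0" unfolding v_def y_def by (rule rl(2))
    have w_lim: "w \<longlonglongrightarrow> 0" unfolding w_def by (rule rl(3))
    have lower: "\<forall>\<^sub>F n in sequentially. - (\<bar>v n\<bar> + w n) \<le> d n"
    proof -
      have "\<forall>\<^sub>F n in sequentially. y n < 1/2" by (rule order_tendstoD(2)[OF y_lim]) simp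
      with P_eq Q_eq K B.t_pos B.nbr_blocks_subset[OF assms(5)] B.finite_hit_cells pos
      show ?thesis
      proof eventually_elim
        case (elim n)
        interpret level_field M \<xi> "x n" by (rule L)
        let ?Z = "hit_cells (C n) (B.t n)"
        have y_eq: "y n = real (card (block (B.t n) (B.t n) 0)) * last_prob (future R (B.t n))
          + real (card (nbr_cube :: (int^'d) set)) * ((real (card (block (B.t n) (B.t n) 0)) * exc_prob)\<^sup>2
          + \<alpha> n + 2 * ((real (card (block (B.t n) (B.t n) 0)) - real (card (block (B.t n) (B.s n) 0))) * exc_prob))"
          unfolding y_def n3_def elim(2) E_eq B.V_def B.W_def ..
        have "(1 - y n) ^ card ?Z - real (card ?Z) * \<alpha> n
            - real (card ?Z) * ((B.V n - B.W n) * exc_prob) \<le> le_prob (D n)"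
          unfolding y_eq B.V_def B.W_def
        proof (rule max_prob_lower[OF assms(2) mix elim(6)])
          show "D n \<subseteq> (\<Union>z\<in>?Z. block (B.t n) (B.t n) z)"
            unfolding B.D_eq using elim(4) by (intro subset_blocks_hits) auto
        qed (use elim B.gap in \<open>auto simp flip: y_eq\<close>)
        then have "(1 - y n) ^ B.m n - w n \<le> P n"
          unfolding w_def elim(1) E_eq B.m_def by simp
        moreover have "exp (- (real (B.m n) * y n + 2 * (real (B.m n) * y n) * y n)) \<le> (1 - y n) ^ B.m n"
        proof (rule one_minus_power_ge)
          have "B.W n \<le> B.V n"
            unfolding B.W_def B.V_def using core_subset[OF B.gap] by (simp add: card_mono)
          moreover have "0 \<le> E n" using Q_nonneg[of n] Q_le[of n] by linarith
          ultimately show "0 \<le> y n"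
            unfolding y_def n3_def using elim(7) Q_nonneg[of n] mixing_nonneg[OF mix] by simp
        qed (use elim(8) in simp)
        moreover have "- \<bar>v n\<bar> \<le> exp (- (real (B.m n) * y n + 2 * (real (B.m n) * y n) * y n)) - exp (- (N n * Q n))"
          unfolding v_def using elim(7) Q_nonneg[of n] by (intro exp_minus_diff_ge) simp
        ultimately show ?case unfolding d_def by linarith
      qed
    qed
    have "(\<lambda>n. - (\<bar>v n\<bar> + w n)) \<longlonglongrightarrow> - (\<bar>0\<bar> + 0)"
      by (intro tendsto_intros v_lim w_lim)
    \<comment> \<open>The upper estimate of the first part and the lower one enclose the exact
      difference.\<close>
    then have "d \<longlonglongrightarrow> 0"
      by (intro tendsto_sandwich[OF lower upper _ u_lim]) simp
    then show ?thesis by (intro exI[of _ d]) (simp add: d_def)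
  qed
  show ?thesis using part1 part2 unfolding P_def Q_def N_def E_def by blast
qed

end
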